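(* Consider a fluid timed Petri net that has no priority rules, is non-Zeno, and admits a positive stoichiometric invariant $e$. Then its throughput vector $\rho\in\mathbb{R}^{\mathcal{Q}}$ is given by $$\forall q\in\mathcal{Q},\qquad \rho_q=e_q\,\min_{\sigma}\ \sum_{F\in\mathcal{F}(\sigma)}\phi^{\sigma}_{F,q}\,\frac{\langle\mu_F^{\sigma},D^{\sigma}m^{\sigma}\rangle}{\langle\mu_F^{\sigma},\tau^{\sigma}\rangle},$$ where the minimum is taken over all policies $\sigma$.
   Context: A fluid timed Petri net without priority rules consists of: two finite disjoint sets $\mathcal{P}$ (places) and $\mathcal{Q}$ (transitions); a directed bipartite graph on $\mathcal{P}\cup\mathcal{Q}$, where $x^{\mathrm{in}}$ (resp. $x^{\mathrm{out}}$) denotes the set of vertices $y$ with an arc from $y$ to $x$ (resp. from $x$ to $y$), and every transition has at least one upstream place; an initial marking $m_p\ge 0$ and a holding time $\tau_p\ge 0$ for each place $p$; a weight $\alpha_{qp}>0$ for each arc from place $p$ to transition $q$, and a weight $\alpha_{pq}>0$ for each arc from transition $q$ to place $p$. Each place $p$ is of one of two kinds. Either $p$ is ruled by (proportional) preselection: a probability vector $(\pi_{qp})_{q\in p^{\mathrm{out}}}$ is given, and every $q\in p^{\mathrm{out}}$ has $p$ as its only upstream place. Or $p$ has at most one downstream transition $q$, and then one sets $\pi_{qp}=1$. Let $T=\max_p\tau_p$. Dynamics: a trajectory is a function $z=(z_q)_{q\in\mathcal{Q}}:[-T,\infty)\to\mathbb{R}^{\mathcal{Q}}$ such that for all $t>0$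 and $q\in\mathcal{Q}$, $$z_q(t)=\min_{p\in q^{\mathrm{in}}}\ \pi_{qp}\,\alpha_{qp}^{-1}\Big(m_p+\sum_{q'\in p^{\mathrm{in}}}\alpha_{pq'}\,z_{q'}(t-\tau_p)\Big).$$ The net is non-Zeno if its directed graph contains no directed circuit all of whose places have zero holding time. A stoichiometric invariant is a vector $e\in\mathbb{R}^{\mathcal{Q}}$ such that for all $q\in\mathcal{Q}$ and all $p\in q^{\mathrm{in}}$, $e_q=\pi_{qp}\alpha_{qp}^{-1}\sum_{q'\in p^{\mathrm{in}}}\alpha_{pq'}e_{q'}$; it is positive if all $e_q>0$. Throughput vector: $\rho=\lim_{t\to\infty}z(t)/t$, where $z$ is any trajectory with continuous restriction to $[-T,0]$; under the hypotheses here this limit exists and does not depend on the trajectory. Policies: a policy is a map $\sigma:\mathcal{Q}\to\mathcal{P}$ with $\sigma(q)\in q^{\mathrm{in}}$ for all $q$. With $\alpha_{pq'}:=0$ when $q'\notin p^{\mathrm{in}}$, the matrix $P^\sigma$ with entries $P^{\sigma}_{qq'}=e_q^{-1}\,\pi_{q\sigma(q)}\,\alpha_{q\sigma(q)}^{-1}\,\alpha_{\sigma(q)q'}\,e_{q'}$ ($q,q'\in\mathcal{Q}$) is stochastic. $\mathcal{F}(\sigma)$ is the set of final (i.e. closed recurrent) classes of $P^\sigma$: strongly connected components of the digraph of $P^\sigma$ with no access to another component. $\mu_F^\sigma$ is the unique invariant probability measure of $P^\sigma$ supported by $F\in\mathcal{F}(\sigma)$. $\phi^\sigma_{F,q}$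 is the probability that the Markov chain with transition matrix $P^\sigma$ started at $q$ eventually reaches $F$. Finally $m^\sigma=(m_{\sigma(q)})_{q}$, $\tau^\sigma=(\tau_{\sigma(q)})_q$, and $D^\sigma$ is the diagonal matrix with diagonal entries $e_q^{-1}\alpha_{q\sigma(q)}^{-1}\pi_{q\sigma(q)}$. *)

theory Defs
  imports "HOL-Analysis.Analysis" "HOL-Probability.Probability"
begin

section \<open>Fluid timed Petri nets without priority rules\<close>

text \<open>
  Places and transitions are the elements of the finite types \<open>'p\<close> and \<open>'q\<close>, so they are
  automatically disjoint.  An arc from place \<open>p\<close> to transition \<open>q\<close> is \<open>(p, q) \<in> arcs_PT N\<close>, and an
  arc from transition \<open>q\<close> to place \<open>p\<close> is \<open>(q, p) \<in> arcs_TP N\<close>.  As in the notation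
  $\alpha_{qp}$, $\alpha_{pq}$, $\pi_{qp}$, the first argument of a weight or of the routing
  function is the head of the arc and the second one is its tail.  Values at pairs that are not
  arcs carry no meaning and are never used.
\<close>

record ('p, 'q) petri_net =
  arcs_PT :: "('p \<times> 'q) set"
  arcs_TP :: "('q \<times> 'p) set"
  marking :: "'p \<Rightarrow> real"
  holding :: "'p \<Rightarrow> real"
  weight_PT :: "'q \<Rightarrow> 'p \<Rightarrow> real"
  weight_TP :: "'p \<Rightarrow> 'q \<Rightarrow> real"
  routing :: "'q \<Rightarrow> 'p \<Rightarrow> real"

definition place_in :: "('p, 'q) petri_net \<Rightarrow> 'p \<Rightarrow> 'q set" where
  "place_in N p = {q. (q, p) \<in> arcs_TP N}"

definition place_out :: "('p, 'q) petri_net \<Rightarrow> 'p \<Rightarrow> 'q set" where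
  "place_out N p = {q. (p, q) \<in> arcs_PT N}"

definition trans_in :: "('p, 'q) petri_net \<Rightarrow> 'q \<Rightarrow> 'p set" where
  "trans_in N q = {p. (p, q) \<in> arcs_PT N}"

definition ruled_by_preselection :: "('p, 'q) petri_net \<Rightarrow> 'p \<Rightarrow> bool" where
  "ruled_by_preselection N p \<longleftrightarrow>
     (\<forall>q\<in>place_out N p. 0 \<le> routing N q p) \<and>
     (\<Sum>q\<in>place_out N p. routing N q p) = 1 \<and>
     (\<forall>q\<in>place_out N p. trans_in N q = {p})"

definition conflict_free :: "('p, 'q) petri_net \<Rightarrow> 'p \<Rightarrow> bool" where
  "conflict_free N p \<longleftrightarrow>
     card (place_out N p) \<le> 1 \<and> (\<forall>q\<in>place_out N p. routing N q p = 1)"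

definition fluid_petri_net :: "('p::finite, 'q::finite) petri_net \<Rightarrow> bool" where
  "fluid_petri_net N \<longleftrightarrow>
     (\<forall>q. trans_in N q \<noteq> {}) \<and>
     (\<forall>p. 0 \<le> marking N p) \<and>
     (\<forall>p. 0 \<le> holding N p) \<and>
     (\<forall>(p, q)\<in>arcs_PT N. 0 < weight_PT N q p) \<and>
     (\<forall>(q, p)\<in>arcs_TP N. 0 < weight_TP N p q) \<and>
     (\<forall>p. ruled_by_preselection N p \<or> conflict_free N p)"

definition net_digraph :: "('p, 'q) petri_net \<Rightarrow> ('p + 'q) rel" where
  "net_digraph N =
     {(Inl p, Inr q) | p q. (p, q) \<in> arcs_PT N} \<union> {(Inr q, Inl p) | q p. (q, p) \<in> arcs_TP N}"

text \<open>
  A directed circuit whose places all have zero holding time is a directed circuit of the subgraph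
  induced by all transitions and the places with zero holding time.
\<close>

definition non_zeno :: "('p, 'q) petri_net \<Rightarrow> bool" where
  "non_zeno N \<longleftrightarrow>
     (let V = {Inl p | p. holding N p = 0} \<union> range Inr in acyclic (net_digraph N \<inter> V \<times> V))"

definition stoichiometric_invariant ::
    "('p, 'q) petri_net \<Rightarrow> real ^ 'q \<Rightarrow> bool" where
  "stoichiometric_invariant N e \<longleftrightarrow>
     (\<forall>q. \<forall>p\<in>trans_in N q.
        e $ q = routing N q p * inverse (weight_PT N q p) *
                  (\<Sum>q'\<in>place_in N p. weight_TP N p q' * e $ q'))"


section \<open>Trajectories and throughput\<close>

definition max_holding :: "('p::finite, 'q) petri_net \<Rightarrow> real" where
  "max_holding N = Max (range (holding N))"

text \<open>
  A function on $[-T, \infty)$ is represented by a total function on the reals; as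
  $t - \tau_p \geq -T$ for $t > 0$, its values below $-T$ are never used.
\<close>

definition trajectory :: "('p, 'q) petri_net \<Rightarrow> (real \<Rightarrow> real ^ 'q) \<Rightarrow> bool" where
  "trajectory N z \<longleftrightarrow>
     (\<forall>t>0. \<forall>q.
        z t $ q = (MIN p\<in>trans_in N q.
          routing N q p * inverse (weight_PT N q p) *
            (marking N p +
              (\<Sum>q'\<in>place_in N p. weight_TP N p q' * z (t - holding N p) $ q'))))"

definition cont_start_trajectory ::
    "('p::finite, 'q::finite) petri_net \<Rightarrow> (real \<Rightarrow> real ^ 'q) \<Rightarrow> bool" where
  "cont_start_trajectory N z \<longleftrightarrow> trajectory N z \<and> continuous_on {- max_holding N..0} z"

text \<open>
  Independence of the trajectory is part of the notion: all trajectories with a continuous start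
  must have the limit \<open>\<rho>\<close>, and there must be at least one of them.
\<close>

definition has_throughput ::
    "('p::finite, 'q::finite) petri_net \<Rightarrow> real ^ 'q \<Rightarrow> bool" where
  "has_throughput N \<rho> \<longleftrightarrow>
     (\<exists>z. cont_start_trajectory N z) \<and>
     (\<forall>z. cont_start_trajectory N z \<longrightarrow> ((\<lambda>t. z t /\<^sub>R t) \<longlongrightarrow> \<rho>) at_top)"

definition throughput :: "('p::finite, 'q::finite) petri_net \<Rightarrow> real ^ 'q" where
  "throughput N = (THE \<rho>. has_throughput N \<rho>)"


section \<open>Finite Markov chains\<close>

definition matrix_digraph :: "real ^ 'n ^ 'n \<Rightarrow> 'n rel" where
  "matrix_digraph P = {(i, j). 0 < P $ i $ j}"

definition strong_components :: "'n rel \<Rightarrow> 'n set set" where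
  "strong_components R = UNIV // {(i, j). (i, j) \<in> R\<^sup>* \<and> (j, i) \<in> R\<^sup>*}"

definition final_classes :: "real ^ 'n ^ 'n \<Rightarrow> 'n set set" where
  "final_classes P =
     {F \<in> strong_components (matrix_digraph P). \<forall>i\<in>F. \<forall>j. (i, j) \<in> (matrix_digraph P)\<^sup>* \<longrightarrow> j \<in> F}"

definition invariant_measure_on :: "real ^ 'n ^ 'n \<Rightarrow> 'n set \<Rightarrow> real ^ 'n \<Rightarrow> bool" where
  "invariant_measure_on P F \<mu> \<longleftrightarrow>
     (\<forall>i. 0 \<le> \<mu> $ i) \<and> (\<Sum>i\<in>UNIV. \<mu> $ i) = 1 \<and> (\<forall>i. i \<notin> F \<longrightarrow> \<mu> $ i = 0) \<and> \<mu> v* P = \<mu>"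

definition invariant_measure :: "real ^ 'n ^ 'n \<Rightarrow> 'n set \<Rightarrow> real ^ 'n" where
  "invariant_measure P F = (THE \<mu>. invariant_measure_on P F \<mu>)"

text \<open>
  Law, on the space of infinite paths, of the Markov chain with transition matrix \<open>P\<close> started
  at \<open>i\<close>; it is determined by its finite-dimensional distributions.
\<close>

definition is_chain_law :: "real ^ 'n ^ 'n \<Rightarrow> 'n \<Rightarrow> (nat \<Rightarrow> 'n) measure \<Rightarrow> bool" where
  "is_chain_law P i M \<longleftrightarrow>
     prob_space M \<and> sets M = sets (\<Pi>\<^sub>M n\<in>(UNIV :: nat set). count_space UNIV) \<and>
     (\<forall>n x. measure M {\<omega>. \<forall>k\<le>n. \<omega> k = x k} =
        (if x 0 = i then \<Prod>k<n. P $ x k $ x (Suc k) else 0))"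

definition chain_law :: "real ^ 'n ^ 'n \<Rightarrow> 'n \<Rightarrow> (nat \<Rightarrow> 'n) measure" where
  "chain_law P i = (THE M. is_chain_law P i M)"

definition reach_prob :: "real ^ 'n ^ 'n \<Rightarrow> 'n set \<Rightarrow> 'n \<Rightarrow> real" where
  "reach_prob P F i = measure (chain_law P i) {\<omega>. \<exists>n. \<omega> n \<in> F}"


section \<open>Policies\<close>

definition policies :: "('p, 'q) petri_net \<Rightarrow> ('q \<Rightarrow> 'p) set" where
  "policies N = {\<sigma>. \<forall>q. \<sigma> q \<in> trans_in N q}"

definition policy_matrix ::
    "('p, 'q) petri_net \<Rightarrow> real ^ 'q \<Rightarrow> ('q \<Rightarrow> 'p) \<Rightarrow> real ^ 'q ^ 'q" where
  "policy_matrix N e \<sigma> =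
     (\<chi> q q'. inverse (e $ q) * routing N q (\<sigma> q) * inverse (weight_PT N q (\<sigma> q)) *
        (if q' \<in> place_in N (\<sigma> q) then weight_TP N (\<sigma> q) q' else 0) * e $ q')"

definition policy_marking :: "('p, 'q) petri_net \<Rightarrow> ('q \<Rightarrow> 'p) \<Rightarrow> real ^ 'q" where
  "policy_marking N \<sigma> = (\<chi> q. marking N (\<sigma> q))"

definition policy_holding :: "('p, 'q) petri_net \<Rightarrow> ('q \<Rightarrow> 'p) \<Rightarrow> real ^ 'q" where
  "policy_holding N \<sigma> = (\<chi> q. holding N (\<sigma> q))"

definition policy_diag ::
    "('p, 'q) petri_net \<Rightarrow> real ^ 'q \<Rightarrow> ('q \<Rightarrow> 'p) \<Rightarrow> real ^ 'q ^ 'q" where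
  "policy_diag N e \<sigma> =
     (\<chi> q q'. if q = q'
        then inverse (e $ q) * inverse (weight_PT N q (\<sigma> q)) * routing N q (\<sigma> q) else 0)"

end

theory Submission
  imports Defs
begin

text \<open>
  Divided by the stoichiometric invariant, a trajectory \<open>z\<close> becomes $x_q = z_q / e_q$ and satisfies
  $x_q(t) = \min_p\, (r_{qp} + \sum_j K_{qpj}\, x_j(t - \tau_p))$.  The rows $K_{qp\cdot}$ are
  probability vectors precisely because \<open>e\<close> is a stoichiometric invariant.  So \<open>x\<close> is the value
  function of a semi-Markov decision process: in state \<open>q\<close> one chooses a place \<open>p\<close>, pays $r_{qp}$,
  waits $\tau_p$ and jumps according to $K_{qp\cdot}$.  The throughput is the optimal cost per unit
  of time, and policies of the net are the stationary policies of the process.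

  The heart of the proof is the pair of multichain optimality equations (\<open>optimality_equations\<close>):
  there are a gain \<open>g\<close> and a bias \<open>u\<close> with $g \leq K_p\, g$ for every choice \<open>p\<close>, with
  $u_q + \tau_p g_q \leq r_{qp} + (K_p u)_q$ wherever the first inequality is tight at \<open>q\<close>, and with
  equality throughout for some policy.  Then $t \mapsto t g + u$ is a solution of the dynamics along
  that policy and, for large \<open>t\<close>, a subsolution for all choices: where $g_q < (K_p\, g)_q$, the term
  growing with \<open>t\<close> wins.  A maximum principle, valid because non-Zeno nets admit induction along the
  dynamics (\<open>wf_feeds\<close>), keeps \<open>x\<close> within a bounded distance of this line, so $x(t)/t$ tends to \<open>g\<close>.
  The upper half of the argument applies to any policy, hence \<open>g\<close> is at most the gain of every policy.

  The optimality equations come from discounting.  With discount factor $1 - a \tau_p$ the dynamic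
  programming equation has a solution for small \<open>a > 0\<close> (\<open>discounted_solution_exists\<close>), since
  non-Zenoness makes it a contraction in a suitable weighted maximum norm.  As there are finitely
  many policies, one of them is optimal for a sequence of \<open>a\<close> tending to zero.  For a fixed policy the
  discounted value is $g/a + u + O(a)$ (\<open>discounted_expansion\<close>), and comparing the coefficients of
  $1/a$ and of $1$ in the discounted inequalities gives the equations.  The factor is linear in \<open>a\<close>
  instead of exponential, which makes the error in this expansion an exact discounted value itself.

  For a single policy with matrix \<open>P\<close>, the equations read $g = P g$ and $u + \tau g = b + P u$.
  Pairing the second with the invariant measure of a final class eliminates \<open>u\<close>; the gain is constant
  on the class and equals the quotient in the theorem.  A harmonic vector is determined by its values
  on the final classes, and the reachability probabilities provide the harmonic vector with values
  one on a given class and zero on the others.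
\<close>

section \<open>Auxiliary facts\<close>

lemma minimizer_exists:
  fixes f :: "'a \<Rightarrow> 'b::linorder"
  assumes "finite S" "S \<noteq> {}"
  shows "\<exists>m\<in>S. \<forall>k\<in>S. f m \<le> f k"
  using arg_min_if_finite[OF assms, of f] by (meson not_le_imp_less)

lemma continuous_on_Min_finite:
  fixes f :: "'i \<Rightarrow> 'a::topological_space \<Rightarrow> real"
  assumes "finite I" "I \<noteq> {}" "\<And>i. i \<in> I \<Longrightarrow> continuous_on S (f i)"
  shows "continuous_on S (\<lambda>x. MIN i\<in>I. f i x)"
  using assms
proof (induction rule: finite_ne_induct)
  case (insert i I)
  then have "continuous_on S (\<lambda>x. min (f i x) (MIN i\<in>I. f i x))"
    by (intro continuous_intros) auto
  then show ?case
    using insert by simp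
qed simp

text \<open>
  The range of a linear map between finite-dimensional spaces is a closed subspace.
\<close>

lemma linear_limit_in_range:
  fixes f :: "real ^ 'm \<Rightarrow> real ^ 'n"
  assumes f: "linear f" and lim: "(\<lambda>n. f (v n)) \<longlonglongrightarrow> y"
  shows "\<exists>u. f u = y"
proof -
  have "closed (range f)"
    using f by (intro closed_subspace linear_subspace_image subspace_UNIV)
  then have "y \<in> range f"
    by (rule closed_sequentially[OF _ _ lim]) simp
  then show ?thesis
    by auto
qed

text \<open>
  Lexicographic comparison: as \<open>a\<close> tends to zero, the sign of the expression is decided by its first
  nonzero coefficient.
\<close>

lemma frequently_quadratic_nonneg:
  fixes x y z :: real
  assumes a: "a \<longlonglongrightarrow> 0" "\<And>n. 0 < a n"
    and inf: "\<exists>\<^sub>F n in sequentially. 0 \<le> x + a n * y + (a n)^2 * z"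
  shows "0 \<le> x \<and> (x = 0 \<longrightarrow> 0 \<le> y)"
proof (intro conjI impI)
  have nonneg: "0 \<le> c" if "f \<longlonglongrightarrow> c" "\<exists>\<^sub>F n in sequentially. 0 \<le> f n" for c :: real and f
  proof (rule ccontr)
    assume "\<not> 0 \<le> c"
    then have "\<forall>\<^sub>F n in sequentially. f n < 0"
      using that(1) by (intro order_tendstoD) auto
    then show False
      using that(2) unfolding frequently_def by (auto elim!: notE eventually_mono)
  qed
  have "(\<lambda>n. x + a n * y + (a n)^2 * z) \<longlonglongrightarrow> x + 0 * y + 0^2 * z"
    by (intro tendsto_intros a)
  then show "0 \<le> x"
    using nonneg[OF _ inf] by simp
  assume "x = 0"
  have "(\<lambda>n. y + a n * z) \<longlonglongrightarrow> y + 0 * z"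
    by (intro tendsto_intros a)
  moreover have "\<exists>\<^sub>F n in sequentially. 0 \<le> y + a n * z"
    using inf
  proof (rule frequently_elim1)
    fix n assume "0 \<le> x + a n * y + (a n)^2 * z"
    then have "0 \<le> a n * (y + a n * z)"
      using \<open>x = 0\<close> by (simp add: algebra_simps power2_eq_square)
    then show "0 \<le> y + a n * z"
      using a(2)[of n] by (simp add: zero_le_mult_iff)
  qed
  ultimately show "0 \<le> y"
    using nonneg by fastforce
qed

lemma tendsto_slope_from_lines:
  fixes f :: "real \<Rightarrow> real"
  assumes lower: "\<And>t. t1 \<le> t \<Longrightarrow> t * c - C \<le> f t" and upper: "\<And>t. 0 \<le> t \<Longrightarrow> f t \<le> t * c + C'"
  shows "((\<lambda>t. f t / t) \<longlongrightarrow> c) at_top"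
proof (rule tendsto_sandwich)
  show "\<forall>\<^sub>F t in at_top. c - C / t \<le> f t / t"
    using eventually_ge_at_top[of "max 1 t1"]
  proof (rule eventually_mono)
    fix t assume "max 1 t1 \<le> t"
    then have "(t * c - C) / t \<le> f t / t" "0 < t"
      using lower by (auto intro!: divide_right_mono)
    then show "c - C / t \<le> f t / t"
      by (simp add: diff_divide_distrib)
  qed
  show "\<forall>\<^sub>F t in at_top. f t / t \<le> c + C' / t"
    using eventually_ge_at_top[of 1]
  proof (rule eventually_mono)
    fix t :: real assume "1 \<le> t"
    then have "f t / t \<le> (t * c + C') / t" "0 < t"
      using upper by (auto intro!: divide_right_mono)
    then show "f t / t \<le> c + C' / t"
      by (simp add: add_divide_distrib)
  qed
  have "((\<lambda>t. c - C / t) \<longlongrightarrow> c - 0) at_top" "((\<lambda>t. c + C' / t) \<longlongrightarrow> c + 0) at_top"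
    by (intro tendsto_intros tendsto_divide_0[OF tendsto_const] filterlim_at_top_imp_at_infinity filterlim_ident)+
  then show "((\<lambda>t. c - C / t) \<longlongrightarrow> c) at_top" "((\<lambda>t. c + C' / t) \<longlongrightarrow> c) at_top"
    by simp_all
qed

section \<open>Final classes and harmonic vectors of stochastic matrices\<close>

definition stochastic :: "real ^ 'n ^ 'n \<Rightarrow> bool" where
  "stochastic P \<longleftrightarrow> (\<forall>i j. 0 \<le> P $ i $ j) \<and> (\<forall>i. (\<Sum>j\<in>UNIV. P $ i $ j) = 1)"

text \<open>
  The strong form of "an average is at most the maximum"; it drives all maximum principles for
  harmonic vectors below.
\<close>

lemma average_attains_bound:
  fixes p x :: "'a \<Rightarrow> real"
  assumes "finite S" "\<And>j. j \<in> S \<Longrightarrow> 0 \<le> p j" "sum p S = 1"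
    and le: "\<And>j. j \<in> S \<Longrightarrow> 0 < p j \<Longrightarrow> x j \<le> M"
    and "M \<le> (\<Sum>j\<in>S. p j * x j)" and j: "j \<in> S" "0 < p j"
  shows "x j = M"
proof -
  have nn: "0 \<le> p k * (M - x k)" if "k \<in> S" for k
    using assms(2)[OF that] le[OF that] by (cases "p k = 0") auto
  have "(\<Sum>k\<in>S. p k * (M - x k)) = M - (\<Sum>k\<in>S. p k * x k)"
    using assms(3) by (simp add: right_diff_distrib sum_subtractf flip: sum_distrib_right)
  also have "\<dots> \<le> 0"
    using assms(5) by simp
  finally have "(\<Sum>k\<in>S. p k * (M - x k)) = 0"
    using nn by (meson order_antisym sum_nonneg)
  then have "p j * (M - x j) = 0"
    using nn j \<open>finite S\<close> by (subst (asm) sum_nonneg_eq_0_iff) auto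
  then show ?thesis
    using j by simp
qed

lemma final_class_nonempty: "F \<in> final_classes P \<Longrightarrow> F \<noteq> {}"
  by (auto simp: final_classes_def strong_components_def quotient_def)

lemma final_class_connected:
  "F \<in> final_classes P \<Longrightarrow> i \<in> F \<Longrightarrow> j \<in> F \<Longrightarrow> (i, j) \<in> (matrix_digraph P)\<^sup>*"
  unfolding final_classes_def strong_components_def quotient_def by (blast intro: rtrancl_trans)

lemma final_class_closed:
  "F \<in> final_classes P \<Longrightarrow> i \<in> F \<Longrightarrow> (i, j) \<in> (matrix_digraph P)\<^sup>* \<Longrightarrow> j \<in> F"
  by (auto simp: final_classes_def)

lemma final_class_no_exit:
  assumes "stochastic P" "F \<in> final_classes P" "i \<in> F" "j \<notin> F"
  shows "P $ i $ j = 0"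
proof (rule ccontr)
  assume "P $ i $ j \<noteq> 0"
  then have "(i, j) \<in> matrix_digraph P"
    using assms(1) by (auto simp: matrix_digraph_def stochastic_def order.strict_iff_order)
  then show False
    using final_class_closed assms by blast
qed

lemma final_classes_disjoint:
  assumes F: "F \<in> final_classes P" and G: "G \<in> final_classes P" and "i \<in> F" "i \<in> G"
  shows "F = G"
  using final_class_connected[OF F] final_class_connected[OF G]
    final_class_closed[OF F] final_class_closed[OF G] assms(3,4) by blast

text \<open>
  A vertex from which the fewest vertices are reachable lies in a final class: whatever it reaches
  reaches equally many vertices, hence reaches it back.
\<close>

lemma final_class_reachable:
  fixes P :: "real ^ 'n ^ 'n"
  shows "\<exists>F\<in>final_classes P. \<exists>j\<in>F. (i, j) \<in> (matrix_digraph P)\<^sup>*"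
proof -
  let ?R = "(matrix_digraph P)\<^sup>*"
  obtain j where j: "(i, j) \<in> ?R"
    and least: "\<And>k. (i, k) \<in> ?R \<Longrightarrow> card (?R `` {j}) \<le> card (?R `` {k})"
    using ex_has_least_nat[of "\<lambda>k. (i, k) \<in> ?R" i "\<lambda>k. card (?R `` {k})"] by auto
  define F where "F = {(a, b). (a, b) \<in> ?R \<and> (b, a) \<in> ?R} `` {j}"
  have closed: "b \<in> F" if "a \<in> F" "(a, b) \<in> ?R" for a b
  proof -
    have jb: "(j, b) \<in> ?R"
      using that unfolding F_def by (blast intro: rtrancl_trans)
    then have "card (?R `` {j}) \<le> card (?R `` {b})"
      using least[OF rtrancl_trans[OF j]] by blast
    moreover have "?R `` {b} \<subseteq> ?R `` {j}"
      using jb by (blast intro: rtrancl_trans)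
    ultimately have "?R `` {b} = ?R `` {j}"
      by (intro card_subset_eq) (simp_all add: card_mono order_antisym)
    then show ?thesis
      using jb by (auto simp: F_def)
  qed
  have "F \<in> strong_components (matrix_digraph P)"
    unfolding strong_components_def F_def by (rule quotientI) simp
  then have "F \<in> final_classes P"
    using closed unfolding final_classes_def by blast
  moreover have "j \<in> F"
    by (auto simp: F_def)
  ultimately show ?thesis
    using j by blast
qed

lemma harmonic_maximum_propagates:
  assumes P: "stochastic P" and h: "P *v h = h" and ij: "(i, j) \<in> (matrix_digraph P)\<^sup>*"
    and max: "\<And>k. (i, k) \<in> (matrix_digraph P)\<^sup>* \<Longrightarrow> h $ k \<le> h $ i"
  shows "h $ j = h $ i"
  using ij
proof (induction rule: rtrancl_induct)
  case (step j k)
  have "h $ k = h $ i"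
  proof (rule average_attains_bound[where p = "\<lambda>l. P $ j $ l" and S = UNIV])
    show "h $ l \<le> h $ i" if "0 < P $ j $ l" for l
      using that step(1) by (intro max) (auto simp: matrix_digraph_def intro: rtrancl_into_rtrancl)
    have "(P *v h) $ j = h $ i"
      using h step.IH by simp
    then show "h $ i \<le> (\<Sum>l\<in>UNIV. P $ j $ l * h $ l)"
      by (simp add: matrix_vector_mult_def)
  qed (use P step(2) in \<open>auto simp: stochastic_def matrix_digraph_def\<close>)
  then show ?case .
qed simp

text \<open>
  A maximum over the class propagates to the whole class, which is connected and has no exit.
\<close>

lemma harmonic_constant_on_final_class:
  fixes P :: "real ^ 'n ^ 'n"
  assumes P: "stochastic P" and h: "P *v h = h" and F: "F \<in> final_classes P"
    and ij: "i \<in> F" "j \<in> F"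
  shows "h $ i = h $ j"
proof -
  obtain m where m: "m \<in> F" "\<And>k. k \<in> F \<Longrightarrow> h $ k \<le> h $ m"
    using minimizer_exists[OF finite final_class_nonempty[OF F], of "\<lambda>k. - h $ k"] by auto
  have "h $ k = h $ m" if "k \<in> F" for k
    using m(2) final_class_closed[OF F m(1)] final_class_connected[OF F m(1) that]
    by (intro harmonic_maximum_propagates[OF P h]) simp_all
  then show ?thesis
    using ij by metis
qed

text \<open>
  A global maximum propagates along a path into some final class, where the vector vanishes.
\<close>

lemma harmonic_nonpos:
  fixes P :: "real ^ 'n ^ 'n"
  assumes P: "stochastic P" and h: "P *v h = h"
    and zero: "\<And>F j. F \<in> final_classes P \<Longrightarrow> j \<in> F \<Longrightarrow> h $ j = 0"
  shows "h $ i \<le> 0"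
proof -
  obtain m where m: "\<And>k. h $ k \<le> h $ m"
    using minimizer_exists[of UNIV "\<lambda>k. - h $ k"] by auto
  obtain F j where "F \<in> final_classes P" "j \<in> F" "(m, j) \<in> (matrix_digraph P)\<^sup>*"
    using final_class_reachable by blast
  then have "h $ m = 0"
    using harmonic_maximum_propagates[OF P h, of m j] m zero by auto
  then show ?thesis
    using m[of i] by simp
qed

text \<open>
  Applied to both differences of two harmonic vectors, the previous lemma shows that they agree once
  they agree on the final classes.
\<close>

lemma harmonic_determined_by_final_classes:
  fixes P :: "real ^ 'n ^ 'n"
  assumes P: "stochastic P" and g: "P *v g = g" and h: "P *v h = h"
    and eq: "\<And>F j. F \<in> final_classes P \<Longrightarrow> j \<in> F \<Longrightarrow> g $ j = h $ j"
  shows "g = h"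
proof -
  have "P *v (g - h) = g - h" "P *v (h - g) = h - g"
    using g h by (simp_all add: matrix_vector_mult_diff_distrib)
  from this[THEN harmonic_nonpos[OF P]] have "g $ i - h $ i \<le> 0" "h $ i - g $ i \<le> 0" for i
    using eq by (auto simp: minus_vec_def)
  then show ?thesis
    by (simp add: vec_eq_iff order_antisym)
qed

section \<open>Invariant measures\<close>

lemma vector_matrix_nth: "(\<mu> v* P) $ j = (\<Sum>i\<in>UNIV. \<mu> $ i * P $ i $ j)"
  for P :: "real ^ 'n ^ 'n"
  by (simp add: vector_matrix_mult_def mult.commute)

lemma sum_vector_matrix:
  fixes P :: "real ^ 'n ^ 'n"
  assumes "stochastic P"
  shows "(\<Sum>j\<in>UNIV. (\<mu> v* P) $ j) = (\<Sum>i\<in>UNIV. \<mu> $ i)"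
proof -
  have "(\<Sum>j\<in>UNIV. (\<mu> v* P) $ j) = (\<Sum>i\<in>UNIV. \<Sum>j\<in>UNIV. \<mu> $ i * P $ i $ j)"
    unfolding vector_matrix_nth by (rule sum.swap)
  also have "\<dots> = (\<Sum>i\<in>UNIV. \<mu> $ i)"
    using assms by (simp add: stochastic_def flip: sum_distrib_left)
  finally show ?thesis .
qed

text \<open>
  Brouwer's theorem on the simplex of probability vectors supported by the class.
\<close>

lemma invariant_measure_exists:
  fixes P :: "real ^ 'n ^ 'n"
  assumes P: "stochastic P" and F: "F \<in> final_classes P"
  shows "\<exists>\<mu>. invariant_measure_on P F \<mu>"
proof -
  define S where "S = {\<mu> :: real ^ 'n. (\<forall>i. 0 \<le> \<mu> $ i) \<and> (\<Sum>i\<in>UNIV. \<mu> $ i) = 1 \<and> (\<forall>i. i \<notin> F \<longrightarrow> \<mu> $ i = 0)}"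
  have "S = (\<Inter>i. {\<mu>. 0 \<le> \<mu> $ i}) \<inter> {\<mu>. (\<Sum>i\<in>UNIV. \<mu> $ i) = 1} \<inter> (\<Inter>i\<in>-F. {\<mu>. \<mu> $ i = 0})"
    by (auto simp: S_def)
  moreover have "closed \<dots>"
    by (intro closed_Int closed_INT ballI closed_Collect_le closed_Collect_eq continuous_intros)
  ultimately have "closed S" by simp
  moreover have "bounded S"
  proof (rule boundedI)
    fix \<mu> assume "\<mu> \<in> S"
    then have "(\<Sum>i\<in>UNIV. \<bar>\<mu> $ i\<bar>) = 1"
      by (simp add: S_def)
    then show "norm \<mu> \<le> 1"
      using norm_le_l1_cart[of \<mu>] by simp
  qed
  ultimately have "compact S"
    by (simp add: compact_eq_bounded_closed)
  moreover have "convex S"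
    by (auto simp: S_def convex_def sum.distrib simp flip: sum_distrib_left)
  moreover have "S \<noteq> {}"
  proof -
    obtain i where "i \<in> F" using final_class_nonempty[OF F] by blast
    then have "axis i 1 \<in> S"
      by (auto simp: S_def axis_def)
    then show ?thesis by blast
  qed
  moreover have "continuous_on S (\<lambda>\<mu>. \<mu> v* P)"
    unfolding vector_matrix_mult_def by (intro continuous_intros)
  moreover have "\<mu> v* P \<in> S" if "\<mu> \<in> S" for \<mu>
  proof -
    have "\<mu> $ i * P $ i $ j = 0" if "j \<notin> F" for i j
      using \<open>\<mu> \<in> S\<close> final_class_no_exit[OF P F _ that, of i] by (cases "i \<in> F") (auto simp: S_def)
    then have "(\<mu> v* P) $ j = 0" if "j \<notin> F" for j
      unfolding vector_matrix_nth using that by (intro sum.neutral) blast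
    moreover have "0 \<le> \<mu> $ i * P $ i $ j" for i j
      using \<open>\<mu> \<in> S\<close> P by (auto simp: S_def stochastic_def)
    ultimately show ?thesis
      using \<open>\<mu> \<in> S\<close> unfolding S_def
      by (simp add: sum_vector_matrix[OF P]) (simp add: vector_matrix_nth sum_nonneg)
  qed
  ultimately obtain \<mu> where "\<mu> \<in> S" "\<mu> v* P = \<mu>"
    using brouwer[of S "\<lambda>\<mu>. \<mu> v* P"] by blast
  then show ?thesis
    by (auto simp: S_def invariant_measure_on_def)
qed

lemma invariant_vector_support:
  fixes P :: "real ^ 'n ^ 'n"
  assumes P: "stochastic P" and nn: "\<And>i. 0 \<le> \<mu> $ i" and inv: "\<mu> v* P = \<mu>"
    and ij: "(i, j) \<in> (matrix_digraph P)\<^sup>*" and i: "0 < \<mu> $ i"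
  shows "0 < \<mu> $ j"
  using ij
proof (induction rule: rtrancl_induct)
  case (step j k)
  have "0 < \<mu> $ j * P $ j $ k"
    using step by (simp add: matrix_digraph_def)
  also have "\<dots> \<le> (\<Sum>l\<in>UNIV. \<mu> $ l * P $ l $ k)"
    using nn P by (intro member_le_sum) (auto simp: stochastic_def)
  also have "\<dots> = \<mu> $ k"
    using inv by (simp flip: vector_matrix_nth)
  finally show ?case .
qed (rule i)

lemma invariant_measure_positive:
  fixes P :: "real ^ 'n ^ 'n"
  assumes P: "stochastic P" and F: "F \<in> final_classes P"
    and \<mu>: "invariant_measure_on P F \<mu>" and j: "j \<in> F"
  shows "0 < \<mu> $ j"
proof -
  have "\<exists>i. \<mu> $ i \<noteq> 0"
    using \<mu> unfolding invariant_measure_on_def by (metis sum.neutral zero_neq_one)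
  then obtain i where "i \<in> F" "0 < \<mu> $ i"
    using \<mu> unfolding invariant_measure_on_def by (metis order.strict_iff_order)
  then show ?thesis
    using \<mu> invariant_vector_support[OF P _ _ final_class_connected[OF F _ j]]
    by (auto simp: invariant_measure_on_def)
qed

text \<open>
  Subtract from \<open>\<mu>\<close> the largest multiple of \<open>\<nu>\<close> that leaves a nonnegative vector.  The difference is
  invariant and vanishes somewhere on the class; as the support of a nonnegative invariant vector is
  closed under succession, it vanishes on the whole class.
\<close>

lemma invariant_measure_unique:
  fixes P :: "real ^ 'n ^ 'n"
  assumes P: "stochastic P" and F: "F \<in> final_classes P"
    and \<mu>: "invariant_measure_on P F \<mu>" and \<nu>: "invariant_measure_on P F \<nu>"
  shows "\<mu> = \<nu>"
proof -
  have pos: "0 < \<nu> $ i" if "i \<in> F" for i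
    using invariant_measure_positive[OF P F \<nu> that] .
  obtain m where m: "m \<in> F" "\<And>k. k \<in> F \<Longrightarrow> \<mu> $ m / \<nu> $ m \<le> \<mu> $ k / \<nu> $ k"
    using minimizer_exists[OF finite final_class_nonempty[OF F], of "\<lambda>k. \<mu> $ k / \<nu> $ k"] by auto
  \<comment> \<open>the largest multiple of \<open>\<nu>\<close> below \<open>\<mu>\<close>\<close>
  define c where "c = \<mu> $ m / \<nu> $ m"
  define \<delta> where "\<delta> = \<mu> - c *\<^sub>R \<nu>"
  have out: "\<delta> $ i = 0" if "i \<notin> F" for i
    using \<mu> \<nu> that by (simp add: \<delta>_def invariant_measure_on_def)
  have nn: "0 \<le> \<delta> $ i" for i
  proof (cases "i \<in> F")
    case True
    then show ?thesis
      using m(2)[OF True] pos[OF True] by (simp add: \<delta>_def c_def field_simps)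
  qed (simp add: out)
  have zero: "\<delta> $ m = 0"
    using pos[OF m(1)] by (simp add: \<delta>_def c_def)
  have "\<delta> v* P = \<mu> v* P - c *\<^sub>R (\<nu> v* P)"
    by (simp add: vec_eq_iff vector_matrix_nth \<delta>_def left_diff_distrib sum_subtractf sum_distrib_left mult.assoc)
  then have inv: "\<delta> v* P = \<delta>"
    using \<mu> \<nu> by (simp add: invariant_measure_on_def \<delta>_def)
  have "\<delta> $ i = 0" for i
  proof (cases "i \<in> F")
    case True
    then show ?thesis
      using invariant_vector_support[OF P nn inv final_class_connected[OF F True m(1)]] zero nn[of i]
      by (auto simp: order.strict_iff_order)
  qed (simp add: out)
  then have eq: "\<mu> $ i = c * \<nu> $ i" for i
    by (simp add: \<delta>_def)
  then have "(\<Sum>i\<in>UNIV. \<mu> $ i) = c * (\<Sum>i\<in>UNIV. \<nu> $ i)"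
    by (simp add: sum_distrib_left)
  then have "c = 1"
    using \<mu> \<nu> by (simp add: invariant_measure_on_def)
  then show ?thesis
    using eq by (simp add: vec_eq_iff)
qed

lemma invariant_measure_on_invariant_measure:
  fixes P :: "real ^ 'n ^ 'n"
  assumes "stochastic P" "F \<in> final_classes P"
  shows "invariant_measure_on P F (invariant_measure P F)"
  unfolding invariant_measure_def
  using invariant_measure_exists[OF assms] invariant_measure_unique[OF assms]
  by (metis theI)

section \<open>The law of a finite Markov chain and its reachability probabilities\<close>

abbreviation path_space :: "(nat \<Rightarrow> 'n) measure" where
  "path_space \<equiv> \<Pi>\<^sub>M n\<in>(UNIV :: nat set). count_space UNIV"

lemma space_path_space [simp]: "space (path_space :: (nat \<Rightarrow> 'n) measure) = UNIV"
  by (simp add: space_PiM)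

lemma cylinder_measurable: "{\<omega>. \<forall>k\<le>n. \<omega> k = x k} \<in> sets (path_space :: (nat \<Rightarrow> 'n::finite) measure)"
proof -
  have "{\<omega> \<in> space (path_space :: (nat \<Rightarrow> 'n) measure). \<forall>k\<le>n. \<omega> k = x k} \<in> sets path_space"
    by measurable
  then show ?thesis
    by simp
qed

text \<open>
  The state space being finite, every event that depends on the first coordinates only is a finite
  disjoint union of cylinders, so its probability can be read off from the finite-dimensional
  distributions.
\<close>

lemma measure_eq_sum_cylinders:
  fixes A :: "(nat \<Rightarrow> 'n::finite) set"
  assumes M: "prob_space M" "sets M = sets path_space"
    and A: "\<And>\<omega> \<omega>'. \<omega> \<in> A \<Longrightarrow> (\<And>k. k \<le> n \<Longrightarrow> \<omega>' k = \<omega> k) \<Longrightarrow> \<omega>' \<in> A"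
  shows "A \<in> sets M"
    and "measure M A = (\<Sum>x\<in>({..n} \<rightarrow>\<^sub>E UNIV) \<inter> A. measure M {\<omega>. \<forall>k\<le>n. \<omega> k = x k})"
proof -
  interpret prob_space M by (rule M(1))
  let ?S = "({..n} \<rightarrow>\<^sub>E UNIV) \<inter> A" and ?C = "\<lambda>x. {\<omega>. \<forall>k\<le>n. \<omega> k = x k}"
  have fin: "finite ?S"
    by (simp add: finite_PiE)
  have "A = (\<Union>x\<in>?S. ?C x)"
  proof (intro equalityI subsetI)
    fix \<omega> assume "\<omega> \<in> A"
    then have "restrict \<omega> {..n} \<in> ?S"
      using A by auto
    then show "\<omega> \<in> (\<Union>x\<in>?S. ?C x)"
      by (rule UN_I) simp
  qed (use A in auto)
  moreover have C: "?C x \<in> sets M" for x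
    unfolding M(2) by (rule cylinder_measurable)
  ultimately show "A \<in> sets M"
    using fin by (metis (no_types, lifting) sets.finite_UN)
  have "disjoint_family_on ?C ?S"
  proof (unfold disjoint_family_on_def, intro ballI impI)
    fix x y assume xy: "x \<in> ?S" "y \<in> ?S" "x \<noteq> y"
    then obtain k where "k \<le> n" "x k \<noteq> y k"
      by (metis IntD1 PiE_ext atMost_iff)
    then show "?C x \<inter> ?C y = {}"
      by auto
  qed
  then have "measure M (\<Union>x\<in>?S. ?C x) = (\<Sum>x\<in>?S. measure M (?C x))"
    using fin C by (intro finite_measure_finite_Union) auto
  then show "measure M A = (\<Sum>x\<in>?S. measure M (?C x))"
    using \<open>A = (\<Union>x\<in>?S. ?C x)\<close> by metis
qed

text \<open>
  Driving a path by independent random self-maps of the state space realizes the Markov chain on a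
  product space, without a construction of path measures by conditional kernels.
\<close>

primrec random_map_path :: "'n \<Rightarrow> (nat \<Rightarrow> 'n \<Rightarrow> 'n) \<Rightarrow> nat \<Rightarrow> 'n" where
  "random_map_path i f 0 = i"
| "random_map_path i f (Suc k) = f k (random_map_path i f k)"

lemma random_map_path_eq_iff:
  "(\<forall>k\<le>n. random_map_path i f k = x k) \<longleftrightarrow> x 0 = i \<and> (\<forall>k<n. f k (x k) = x (Suc k))"
proof (induction n)
  case (Suc n)
  then show ?case
    by (auto simp: le_Suc_eq less_Suc_eq all_conj_distrib)
qed auto

text \<open>
  The self-maps are independent and identically distributed, and each has independent values with
  the rows of \<open>P\<close> as laws.  Given a cylinder, different steps then constrain different factors of
  the product space, hence the product formula.
\<close>

lemma chain_law_exists: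
  fixes P :: "real ^ 'n ^ 'n"
  assumes P: "stochastic P"
  shows "\<exists>M. is_chain_law P i M"
proof -
  have nonneg: "0 \<le> P $ a $ b" for a b
    using P by (simp add: stochastic_def)
  define row where "row a = embed_pmf (\<lambda>b. P $ a $ b)" for a
  have row: "pmf (row a) b = P $ a $ b" for a b
    unfolding row_def using P
    by (subst pmf_embed_pmf)
      (auto simp: stochastic_def nn_integral_count_space_finite)
  define D where "D = Pi_pmf UNIV undefined row"
  have D: "measure D {g. g a = b} = P $ a $ b" for a b
  proof -
    have "measure D {g. g a = b} = measure (map_pmf (\<lambda>g. g a) D) {b}"
      by (simp add: vimage_def)
    also have "map_pmf (\<lambda>g. g a) D = row a"
      unfolding D_def by (subst Pi_pmf_component) auto
    finally show ?thesis
      by (simp add: measure_pmf_single row)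
  qed
  define M0 where "M0 = (\<Pi>\<^sub>M n\<in>(UNIV :: nat set). measure_pmf D)"
  interpret product_prob_space "\<lambda>_. measure_pmf D" "UNIV :: nat set"
    by unfold_locales
  have step: "(\<lambda>f. f n a) \<in> measurable M0 (count_space UNIV)" for n a
    unfolding M0_def
    by (rule measurable_compose[where g = "\<lambda>g. g a", OF measurable_component_singleton]) simp_all
  have "(\<lambda>f. random_map_path i f n) \<in> measurable M0 (count_space UNIV)" for n
  proof (induction n)
    case (Suc n)
    show ?case
      unfolding random_map_path.simps
      by (rule measurable_compose_countable[where f = "\<lambda>a f. f n a", OF step Suc])
  qed simp
  then have X: "random_map_path i \<in> measurable M0 path_space"
    by (intro measurable_PiM_single') (auto simp: M0_def)
  have "is_chain_law P i (distr M0 path_space (random_map_path i))"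
    unfolding is_chain_law_def
  proof (intro conjI allI)
    have "prob_space M0"
      unfolding M0_def by (rule prob_space_axioms)
    then show "prob_space (distr M0 path_space (random_map_path i))"
      using X by (rule prob_space.prob_space_distr)
    fix n and x :: "nat \<Rightarrow> 'n"
    have "measure (distr M0 path_space (random_map_path i)) {\<omega>. \<forall>k\<le>n. \<omega> k = x k} =
        measure M0 {f \<in> space M0. \<forall>k\<le>n. random_map_path i f k = x k}"
      using X cylinder_measurable[of n x] by (subst measure_distr) (auto intro!: arg_cong[of _ _ "measure M0"])
    also have "\<dots> = (if x 0 = i then \<Prod>k<n. P $ x k $ x (Suc k) else 0)"
    proof (cases "x 0 = i")
      case True
      have "emeasure M0 {f \<in> space M0. \<forall>k\<in>{..<n}. f k \<in> {g. g (x k) = x (Suc k)}} =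
          (\<Prod>k<n. emeasure D {g. g (x k) = x (Suc k)})"
        unfolding M0_def by (rule emeasure_PiM_Collect) auto
      also have "\<dots> = ennreal (\<Prod>k<n. P $ x k $ x (Suc k))"
        using nonneg by (simp only: measure_pmf.emeasure_eq_measure D) (rule prod_ennreal)
      finally show ?thesis
        using True nonneg unfolding random_map_path_eq_iff
        by (simp add: measure_def prod_nonneg Ball_def)
    qed (simp add: random_map_path_eq_iff)
    finally show "measure (distr M0 path_space (random_map_path i)) {\<omega>. \<forall>k\<le>n. \<omega> k = x k} =
        (if x 0 = i then \<Prod>k<n. P $ x k $ x (Suc k) else 0)" .
  qed simp
  then show ?thesis ..
qed

lemma chain_law_unique:
  fixes P :: "real ^ 'n ^ 'n"
  assumes M: "is_chain_law P i M" and M': "is_chain_law P i M'"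
  shows "M = M'"
proof (rule measure_eqI_PiM_infinite)
  show sets: "sets M = sets path_space" "sets M' = sets path_space"
    using M M' by (simp_all add: is_chain_law_def)
  have prob: "prob_space M" "prob_space M'"
    using M M' by (simp_all add: is_chain_law_def)
  then show "finite_measure M"
    by (simp add: prob_space_def)
  fix J :: "nat set" and A :: "nat \<Rightarrow> 'n set"
  assume J: "finite J"
  define n where "n = Max (insert 0 J)"
  define B where "B = prod_emb UNIV (\<lambda>_. count_space UNIV) J (Pi\<^sub>E J A)"
  have "k \<le> n" if "k \<in> J" for k
    using that J by (simp add: n_def)
  then have B: "\<omega>' \<in> B" if "\<omega> \<in> B" "\<And>k. k \<le> n \<Longrightarrow> \<omega>' k = \<omega> k" for \<omega> \<omega>'
    using that by (auto simp: B_def prod_emb_iff PiE_iff)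
  have "measure M B = (\<Sum>x\<in>({..n} \<rightarrow>\<^sub>E UNIV) \<inter> B. measure M {\<omega>. \<forall>k\<le>n. \<omega> k = x k})"
    by (rule measure_eq_sum_cylinders(2)[OF prob(1) sets(1)]) (rule B)
  also have "\<dots> = (\<Sum>x\<in>({..n} \<rightarrow>\<^sub>E UNIV) \<inter> B. measure M' {\<omega>. \<forall>k\<le>n. \<omega> k = x k})"
    using M M' by (simp add: is_chain_law_def)
  also have "\<dots> = measure M' B"
    by (rule measure_eq_sum_cylinders(2)[OF prob(2) sets(2), symmetric]) (rule B)
  finally have "measure M B = measure M' B" .
  then show "emeasure M (prod_emb UNIV (\<lambda>_. count_space UNIV) J (Pi\<^sub>E J A)) =
      emeasure M' (prod_emb UNIV (\<lambda>_. count_space UNIV) J (Pi\<^sub>E J A))"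
    using prob by (simp add: prob_space_def finite_measure.emeasure_eq_measure flip: B_def)
qed

lemma is_chain_law_chain_law:
  fixes P :: "real ^ 'n ^ 'n"
  assumes "stochastic P"
  shows "is_chain_law P i (chain_law P i)"
proof -
  obtain M where M: "is_chain_law P i M"
    using chain_law_exists[OF assms] by blast
  then show ?thesis
    unfolding chain_law_def by (rule theI) (rule chain_law_unique[OF _ M])
qed

lemma chain_law_initial:
  fixes P :: "real ^ 'n ^ 'n"
  assumes "is_chain_law P i M"
  shows "measure M {\<omega>. \<omega> 0 = j} = (if j = i then 1 else 0)"
proof -
  have "measure M {\<omega>. \<forall>k\<le>0. \<omega> k = j} = (if j = i then 1 else 0)"
    using assms unfolding is_chain_law_def by (auto dest!: spec[of _ 0] spec[of _ "\<lambda>_. j"])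
  then show ?thesis
    by simp
qed

text \<open>
  The Markov property for one step, obtained by summing the product formula over all paths.
\<close>

lemma chain_law_step:
  fixes P :: "real ^ 'n ^ 'n"
  assumes "is_chain_law P i M"
  shows "measure M {\<omega>. \<omega> n = j \<and> \<omega> (Suc n) = k} = measure M {\<omega>. \<omega> n = j} * P $ j $ k"
proof -
  have prob: "prob_space M" and sets: "sets M = sets path_space"
    and cyl: "\<And>n x. measure M {\<omega>. \<forall>k\<le>n. \<omega> k = x k} =
        (if x 0 = i then \<Prod>k<n. P $ x k $ x (Suc k) else 0)"
    using assms by (auto simp: is_chain_law_def)
  interpret prob_space M by fact
  let ?S = "({..n} \<rightarrow>\<^sub>E UNIV) \<inter> {\<omega> :: nat \<Rightarrow> 'n. \<omega> n = j}"
  let ?C = "\<lambda>x. {\<omega> :: nat \<Rightarrow> 'n. \<forall>l\<le>Suc n. \<omega> l = (x(Suc n := k)) l}"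
  have fin: "finite ?S"
    by (simp add: finite_PiE)
  have eq: "{\<omega>. \<omega> n = j \<and> \<omega> (Suc n) = k} = (\<Union>x\<in>?S. ?C x)"
  proof (intro equalityI subsetI)
    fix \<omega> :: "nat \<Rightarrow> 'n" assume "\<omega> \<in> {\<omega>. \<omega> n = j \<and> \<omega> (Suc n) = k}"
    then show "\<omega> \<in> (\<Union>x\<in>?S. ?C x)"
      by (intro UN_I[of "restrict \<omega> {..n}"]) auto
  qed auto
  have "disjoint_family_on ?C ?S"
  proof (unfold disjoint_family_on_def, intro ballI impI)
    fix x y assume xy: "x \<in> ?S" "y \<in> ?S" "x \<noteq> y"
    then obtain l where l: "l \<le> n" "x l \<noteq> y l"
      by (metis IntD1 PiE_ext atMost_iff)
    show "?C x \<inter> ?C y = {}"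
    proof (rule ccontr)
      assume "?C x \<inter> ?C y \<noteq> {}"
      then obtain \<omega> where "\<forall>l\<le>Suc n. \<omega> l = (x(Suc n := k)) l" "\<forall>l\<le>Suc n. \<omega> l = (y(Suc n := k)) l"
        by auto
      then have "x l = y l"
        using l(1) by (metis fun_upd_apply le_SucI not_less_eq_eq order_refl)
      then show False using l by simp
    qed
  qed
  then have "measure M {\<omega>. \<omega> n = j \<and> \<omega> (Suc n) = k} = (\<Sum>x\<in>?S. measure M (?C x))"
    unfolding eq using fin cylinder_measurable[of "Suc n"] sets
    by (intro finite_measure_finite_Union) blast+
  also have "\<dots> = (\<Sum>x\<in>?S. measure M {\<omega>. \<forall>l\<le>n. \<omega> l = x l} * P $ j $ k)"
  proof (intro sum.cong refl)
    fix x assume "x \<in> ?S"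
    moreover have "(\<Prod>l<n. P $ (x(Suc n := k)) l $ (x(Suc n := k)) (Suc l)) = (\<Prod>l<n. P $ x l $ x (Suc l))"
      by (intro prod.cong) auto
    ultimately show "measure M (?C x) = measure M {\<omega>. \<forall>l\<le>n. \<omega> l = x l} * P $ j $ k"
      unfolding cyl prod.lessThan_Suc by simp
  qed
  also have "\<dots> = measure M {\<omega>. \<omega> n = j} * P $ j $ k"
    by (subst measure_eq_sum_cylinders(2)[OF prob sets, where n = n and A = "{\<omega>. \<omega> n = j}"])
      (simp_all add: sum_distrib_right)
  finally show ?thesis .
qed

lemma chain_law_iterate:
  fixes P :: "real ^ 'n ^ 'n"
  assumes M: "is_chain_law P i M"
  shows "(\<Sum>j\<in>UNIV. measure M {\<omega>. \<omega> n = j} * g $ j) = (((*v) P ^^ n) g) $ i"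
proof (induction n arbitrary: g)
  case 0
  have "(\<Sum>j\<in>UNIV. measure M {\<omega>. \<omega> 0 = j} * g $ j) = (\<Sum>j\<in>UNIV. if j = i then g $ j else 0)"
    by (intro sum.cong) (simp_all add: chain_law_initial[OF M])
  then show ?case
    by simp
next
  case (Suc n)
  have prob: "prob_space M" and sets: "sets M = sets path_space"
    using M by (simp_all add: is_chain_law_def)
  interpret prob_space M by fact
  have meas: "{\<omega>. \<omega> n = j \<and> \<omega> (Suc n) = k} \<in> sets M" for j k
    by (rule measure_eq_sum_cylinders(1)[OF prob sets, where n = "Suc n"]) auto
  have "measure M {\<omega>. \<omega> (Suc n) = k} = (\<Sum>j\<in>UNIV. measure M {\<omega>. \<omega> n = j} * P $ j $ k)" for k
  proof -
    have "{\<omega>. \<omega> (Suc n) = k} = (\<Union>j. {\<omega>. \<omega> n = j \<and> \<omega> (Suc n) = k})"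
      by auto
    also have "measure M \<dots> = (\<Sum>j\<in>UNIV. measure M {\<omega>. \<omega> n = j \<and> \<omega> (Suc n) = k})"
      using meas by (intro finite_measure_finite_Union) (auto simp: disjoint_family_on_def)
    finally show ?thesis
      by (simp only: chain_law_step[OF M])
  qed
  then have "(\<Sum>k\<in>UNIV. measure M {\<omega>. \<omega> (Suc n) = k} * g $ k) =
      (\<Sum>k\<in>UNIV. \<Sum>j\<in>UNIV. measure M {\<omega>. \<omega> n = j} * P $ j $ k * g $ k)"
    by (simp add: sum_distrib_right)
  also have "\<dots> = (\<Sum>j\<in>UNIV. measure M {\<omega>. \<omega> n = j} * (P *v g) $ j)"
    by (subst sum.swap) (simp add: matrix_vector_mult_def sum_distrib_left mult.assoc)
  also have "\<dots> = (((*v) P ^^ Suc n) g) $ i"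
    by (simp only: Suc.IH funpow_Suc_right o_apply)
  finally show ?case .
qed

definition indicator_vec :: "'n set \<Rightarrow> real ^ 'n" where
  "indicator_vec F = (\<chi> j. indicator F j)"

text \<open>
  For a closed set, having visited it up to time \<open>n\<close> is almost surely the same as being in it at
  time \<open>n\<close>.  So the probabilities of reaching it in time are the entries of the iterates of \<open>P\<close> on the
  indicator vector, and they increase to the reachability probability.
\<close>

lemma iterates_tendsto_reach_prob:
  fixes P :: "real ^ 'n ^ 'n"
  assumes P: "stochastic P" and closed: "\<And>j k. j \<in> F \<Longrightarrow> k \<notin> F \<Longrightarrow> P $ j $ k = 0"
  shows "(\<lambda>n. (((*v) P ^^ n) (indicator_vec F)) $ i) \<longlonglongrightarrow> reach_prob P F i"
proof -
  define M where "M = chain_law P i"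
  have M: "is_chain_law P i M"
    unfolding M_def by (rule is_chain_law_chain_law[OF P])
  have prob: "prob_space M" and sets: "sets M = sets path_space"
    using M by (simp_all add: is_chain_law_def)
  interpret prob_space M by fact
  have in_F: "{\<omega>. \<omega> n \<in> F} \<in> sets M" for n
    by (rule measure_eq_sum_cylinders(1)[OF prob sets, where n = n]) auto
  have hit: "{\<omega>. \<exists>k\<le>n. \<omega> k \<in> F} \<in> sets M" for n
  proof -
    have "(\<Union>k\<le>n. {\<omega>. \<omega> k \<in> F}) \<in> sets M"
      using in_F by blast
    also have "(\<Union>k\<le>n. {\<omega>. \<omega> k \<in> F}) = {\<omega>. \<exists>k\<le>n. \<omega> k \<in> F}"
      by auto
    finally show ?thesis .
  qed
  have exit: "{\<omega>. \<omega> n \<in> F \<and> \<omega> (Suc n) \<notin> F} \<in> null_sets M" for n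
  proof -
    have meas: "{\<omega>. \<omega> n = j \<and> \<omega> (Suc n) = k} \<in> sets M" for j k
      by (rule measure_eq_sum_cylinders(1)[OF prob sets, where n = "Suc n"]) auto
    have "{\<omega>. \<omega> n = j \<and> \<omega> (Suc n) = k} \<in> null_sets M" if "j \<in> F" "k \<notin> F" for j k
    proof (rule null_setsI[OF _ meas])
      have "measure M {\<omega>. \<omega> n = j \<and> \<omega> (Suc n) = k} = 0"
        by (rule trans[OF chain_law_step[OF M]]) (simp only: closed[OF that] mult_zero_right)
      then show "emeasure M {\<omega>. \<omega> n = j \<and> \<omega> (Suc n) = k} = 0"
        unfolding emeasure_eq_measure by simp
    qed
    then have "(\<Union>j\<in>F. \<Union>k\<in>-F. {\<omega>. \<omega> n = j \<and> \<omega> (Suc n) = k}) \<in> null_sets M"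
      by (intro null_sets_UN' countable_finite) auto
    also have "(\<Union>j\<in>F. \<Union>k\<in>-F. {\<omega>. \<omega> n = j \<and> \<omega> (Suc n) = k}) = {\<omega>. \<omega> n \<in> F \<and> \<omega> (Suc n) \<notin> F}"
      by auto
    finally show ?thesis .
  qed
  have stay: "AE \<omega> in M. \<forall>n. \<omega> n \<in> F \<longrightarrow> \<omega> (Suc n) \<in> F"
    unfolding AE_all_countable
  proof
    fix n show "AE \<omega> in M. \<omega> n \<in> F \<longrightarrow> \<omega> (Suc n) \<in> F"
      by (rule AE_I'[OF exit[of n]]) auto
  qed
  have hit_eq: "measure M {\<omega>. \<exists>k\<le>n. \<omega> k \<in> F} = (((*v) P ^^ n) (indicator_vec F)) $ i" for n
  proof -
    have "measure M {\<omega>. \<exists>k\<le>n. \<omega> k \<in> F} = measure M {\<omega>. \<omega> n \<in> F}"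
    proof (rule finite_measure_eq_AE)
      show "AE \<omega> in M. (\<omega> \<in> {\<omega>. \<exists>k\<le>n. \<omega> k \<in> F}) = (\<omega> \<in> {\<omega>. \<omega> n \<in> F})"
        using stay
      proof (rule AE_mp, intro AE_I2 impI)
        fix \<omega> assume \<omega>: "\<forall>n. \<omega> n \<in> F \<longrightarrow> \<omega> (Suc n) \<in> F"
        have "\<omega> n \<in> F" if "k \<le> n" "\<omega> k \<in> F" for k
          using that by (induction rule: dec_induct) (use \<omega> in auto)
        then show "(\<omega> \<in> {\<omega>. \<exists>k\<le>n. \<omega> k \<in> F}) = (\<omega> \<in> {\<omega>. \<omega> n \<in> F})"
          by blast
      qed
    qed (use hit in_F in auto)
    also have "{\<omega>. \<omega> n \<in> F} = (\<Union>j\<in>F. {\<omega>. \<omega> n = j})"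
      by auto
    also have "measure M \<dots> = (\<Sum>j\<in>F. measure M {\<omega>. \<omega> n = j})"
    proof (rule finite_measure_finite_Union)
      have "{\<omega>. \<omega> n = j} \<in> sets M" for j
        by (rule measure_eq_sum_cylinders(1)[OF prob sets, where n = n]) auto
      then show "(\<lambda>j. {\<omega>. \<omega> n = j}) ` F \<subseteq> sets M"
        by blast
    qed (auto simp: disjoint_family_on_def)
    also have "\<dots> = (\<Sum>j\<in>UNIV. measure M {\<omega>. \<omega> n = j} * indicator_vec F $ j)"
      by (simp add: indicator_vec_def indicator_def if_distrib[of "\<lambda>x. _ * x"] sum.If_cases cong: if_cong)
    also have "\<dots> = (((*v) P ^^ n) (indicator_vec F)) $ i"
      by (rule chain_law_iterate[OF M])
    finally show ?thesis .
  qed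
  have "(\<lambda>n. measure M {\<omega>. \<exists>k\<le>n. \<omega> k \<in> F}) \<longlonglongrightarrow> measure M (\<Union>n. {\<omega>. \<exists>k\<le>n. \<omega> k \<in> F})"
  proof (rule finite_Lim_measure_incseq)
    show "incseq (\<lambda>n. {\<omega>. \<exists>k\<le>n. \<omega> k \<in> F})"
      by (rule incseq_SucI) (auto intro: le_SucI)
  qed (use hit in auto)
  moreover have "(\<Union>n. {\<omega> :: nat \<Rightarrow> 'n. \<exists>k\<le>n. \<omega> k \<in> F}) = {\<omega>. \<exists>n. \<omega> n \<in> F}"
    by auto
  ultimately show ?thesis
    by (simp only: hit_eq reach_prob_def flip: M_def)
qed

text \<open>
  Shifting the sequence of iterates by one leaves the limit unchanged.
\<close>

lemma reach_prob_harmonic: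
  fixes P :: "real ^ 'n ^ 'n"
  assumes P: "stochastic P" and F: "F \<in> final_classes P"
  shows "P *v (\<chi> i. reach_prob P F i) = (\<chi> i. reach_prob P F i)"
proof -
  let ?u = "\<lambda>n. ((*v) P ^^ n) (indicator_vec F)"
  have lim: "?u \<longlonglongrightarrow> (\<chi> i. reach_prob P F i)"
    using iterates_tendsto_reach_prob[OF P final_class_no_exit[OF P F]]
    by (intro vec_tendstoI) simp
  have "(\<lambda>n. P *v ?u n) \<longlonglongrightarrow> P *v (\<chi> i. reach_prob P F i)"
    using lim by (intro bounded_linear.tendsto[OF matrix_vector_mul_bounded_linear])
  moreover have "(\<lambda>n. P *v ?u n) \<longlonglongrightarrow> (\<chi> i. reach_prob P F i)"
    using LIMSEQ_Suc[OF lim] by simp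
  ultimately show ?thesis
    by (rule LIMSEQ_unique)
qed

lemma reach_prob_on_final_class:
  fixes P :: "real ^ 'n ^ 'n"
  assumes P: "stochastic P" and F: "F \<in> final_classes P" and G: "G \<in> final_classes P" and i: "i \<in> G"
  shows "reach_prob P F i = (if F = G then 1 else 0)"
proof -
  have "(((*v) P ^^ n) (indicator_vec F)) $ j = (if F = G then 1 else 0)" if "j \<in> G" for n j
    using that
  proof (induction n arbitrary: j)
    case 0
    then have "j \<in> F \<longleftrightarrow> F = G"
      using final_classes_disjoint[OF F G] by blast
    then show ?case
      by (simp add: indicator_vec_def indicator_def)
  next
    case (Suc n)
    have "(P *v ((*v) P ^^ n) (indicator_vec F)) $ j =
        (\<Sum>k\<in>UNIV. P $ j $ k * (if F = G then 1 else 0))"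
      unfolding matrix_vector_mult_def[of P "((*v) P ^^ n) (indicator_vec F)"] vec_lambda_beta
    proof (rule sum.cong)
      fix k
      show "P $ j $ k * ((*v) P ^^ n) (indicator_vec F) $ k = P $ j $ k * (if F = G then 1 else 0)"
        using Suc.IH[of k] final_class_no_exit[OF P G Suc.prems, of k] by (cases "k \<in> G") simp_all
    qed simp
    then show ?case
      using P by (simp add: stochastic_def)
  qed
  then have "(\<lambda>n. (((*v) P ^^ n) (indicator_vec F)) $ i) \<longlonglongrightarrow> (if F = G then 1 else 0)"
    using i by simp
  moreover have "(\<lambda>n. (((*v) P ^^ n) (indicator_vec F)) $ i) \<longlonglongrightarrow> reach_prob P F i"
    by (rule iterates_tendsto_reach_prob[OF P final_class_no_exit[OF P F]])
  ultimately show ?thesis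
    by (rule LIMSEQ_unique[rotated])
qed

text \<open>
  The right-hand side is harmonic and takes the prescribed value on each final class.
\<close>

lemma harmonic_eq_sum_reach_prob:
  fixes P :: "real ^ 'n ^ 'n"
  assumes P: "stochastic P" and h: "P *v h = h"
    and g: "\<And>F j. F \<in> final_classes P \<Longrightarrow> j \<in> F \<Longrightarrow> h $ j = g F"
  shows "h $ i = (\<Sum>F\<in>final_classes P. reach_prob P F i * g F)"
proof -
  define k where "k = (\<Sum>F\<in>final_classes P. g F *\<^sub>R (\<chi> i. reach_prob P F i))"
  have "P *v k = (\<Sum>F\<in>final_classes P. P *v (g F *\<^sub>R (\<chi> i. reach_prob P F i)))"
    unfolding k_def by (rule linear_sum) simp
  also have "\<dots> = k"
    unfolding k_def by (rule sum.cong) (simp_all add: matrix_vector_mult_scaleR reach_prob_harmonic[OF P])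
  finally have k: "P *v k = k" .
  have "h = k"
  proof (rule harmonic_determined_by_final_classes[OF P h k])
    fix G j assume G: "G \<in> final_classes P" "j \<in> G"
    have "k $ j = (\<Sum>F\<in>final_classes P. if F = G then g F else 0)"
      unfolding k_def sum_component
      by (rule sum.cong) (simp_all add: reach_prob_on_final_class[OF P _ G])
    then show "h $ j = k $ j"
      using g[OF G] G(1) by simp
  qed
  then show ?thesis
    by (simp add: k_def mult.commute)
qed

text \<open>
  Here \<open>g\<close> is the gain and \<open>u\<close> the bias of a Markov chain with holding times \<open>\<tau>\<close> and costs \<open>b\<close>.
  Pairing the second equation with the invariant measure of a final class cancels \<open>u\<close>.
\<close>

lemma gain_eq_ergodic_average:
  fixes P :: "real ^ 'n ^ 'n"
  assumes P: "stochastic P" and g: "P *v g = g"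
    and u: "\<And>i. u $ i + \<tau> $ i * g $ i = b $ i + (P *v u) $ i"
    and pos: "\<And>F. F \<in> final_classes P \<Longrightarrow> 0 < invariant_measure P F \<bullet> \<tau>"
  shows "g $ i = (\<Sum>F\<in>final_classes P.
    reach_prob P F i * (invariant_measure P F \<bullet> b / (invariant_measure P F \<bullet> \<tau>)))"
proof (rule harmonic_eq_sum_reach_prob[OF P g])
  fix F j assume F: "F \<in> final_classes P" and j: "j \<in> F"
  define \<mu> where "\<mu> = invariant_measure P F"
  have \<mu>: "invariant_measure_on P F \<mu>"
    unfolding \<mu>_def by (rule invariant_measure_on_invariant_measure[OF P F])
  have "\<mu> \<bullet> (P *v u) = (\<mu> v* P) \<bullet> u"
    by (simp add: dot_lmul_matrix)
  then have "\<mu> \<bullet> (P *v u) = \<mu> \<bullet> u"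
    using \<mu> by (simp add: invariant_measure_on_def)
  moreover have "u + (\<chi> i. \<tau> $ i * g $ i) = b + P *v u"
    using u by (simp add: vec_eq_iff)
  then have "\<mu> \<bullet> u + \<mu> \<bullet> (\<chi> i. \<tau> $ i * g $ i) = \<mu> \<bullet> b + \<mu> \<bullet> (P *v u)"
    by (metis inner_add_right)
  ultimately have "\<mu> \<bullet> b = \<mu> \<bullet> (\<chi> i. \<tau> $ i * g $ i)"
    by simp
  also have "\<dots> = (\<Sum>i\<in>UNIV. g $ j * (\<mu> $ i * \<tau> $ i))"
    unfolding inner_vec_def
  proof (rule sum.cong)
    fix i
    show "\<mu> $ i \<bullet> (\<chi> i. \<tau> $ i * g $ i) $ i = g $ j * (\<mu> $ i * \<tau> $ i)"
    proof (cases "i \<in> F")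
      case True
      then show ?thesis
        using harmonic_constant_on_final_class[OF P g F True j] by simp
    next
      case False
      then show ?thesis
        using \<mu> by (simp add: invariant_measure_on_def)
    qed
  qed simp
  also have "\<dots> = g $ j * (\<mu> \<bullet> \<tau>)"
    by (simp add: inner_vec_def sum_distrib_left)
  finally show "g $ j = invariant_measure P F \<bullet> b / (invariant_measure P F \<bullet> \<tau>)"
    using pos[OF F] by (simp add: \<mu>_def field_simps)
qed

section \<open>Semi-Markov decision processes\<close>

text \<open>
  In state \<open>q\<close> one chooses an action in \<open>acts q\<close>, stays for the time \<open>tau p\<close> and jumps to a state
  distributed as \<open>kern q p\<close>.  The levels express non-Zenoness: jumps without delay descend strictly, so
  only boundedly many of them can follow each other.
\<close>

locale semi_markov_decision =
  fixes acts :: "'q::finite \<Rightarrow> 'p::finite set"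
    and kern :: "'q \<Rightarrow> 'p \<Rightarrow> 'q \<Rightarrow> real"
    and tau :: "'p \<Rightarrow> real"
    and lev :: "'q \<Rightarrow> nat"
  assumes acts_nonempty: "acts q \<noteq> {}"
    and kern_nonneg: "p \<in> acts q \<Longrightarrow> 0 \<le> kern q p j"
    and kern_sum: "p \<in> acts q \<Longrightarrow> (\<Sum>j\<in>UNIV. kern q p j) = 1"
    and tau_nonneg: "0 \<le> tau p"
    and lev_decreases: "p \<in> acts q \<Longrightarrow> tau p = 0 \<Longrightarrow> 0 < kern q p j \<Longrightarrow> lev j < lev q"
begin

definition avg :: "'q \<Rightarrow> 'p \<Rightarrow> real ^ 'q \<Rightarrow> real" where
  "avg q p x = (\<Sum>j\<in>UNIV. kern q p j * x $ j)"

lemma avg_linear [simp]: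
  "avg q p (x + y) = avg q p x + avg q p y"
  "avg q p (x - y) = avg q p x - avg q p y"
  "avg q p (- x) = - avg q p x"
  "avg q p (c *\<^sub>R x) = c * avg q p x"
  by (simp_all add: avg_def distrib_left right_diff_distrib sum.distrib sum_subtractf
      sum_negf sum_distrib_left mult.left_commute)

lemma avg_le:
  assumes p: "p \<in> acts q" and le: "\<And>j. 0 < kern q p j \<Longrightarrow> x $ j \<le> y $ j"
  shows "avg q p x \<le> avg q p y"
  unfolding avg_def
proof (rule sum_mono)
  fix j
  show "kern q p j * x $ j \<le> kern q p j * y $ j"
    using kern_nonneg[OF p, of j] le[of j] by (cases "kern q p j = 0") auto
qed

lemma avg_zero [simp]: "avg q p 0 = 0"
  by (simp add: avg_def)

lemma avg_vec [simp]: "p \<in> acts q \<Longrightarrow> avg q p (vec c) = c"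
  by (simp add: avg_def kern_sum flip: sum_distrib_right)

lemma avg_le_const:
  assumes "p \<in> acts q" "\<And>j. 0 < kern q p j \<Longrightarrow> x $ j \<le> c"
  shows "avg q p x \<le> c"
  using avg_le[OF assms(1), of x "vec c"] assms by simp

lemma abs_avg_le:
  assumes p: "p \<in> acts q" and le: "\<And>j. \<bar>x $ j\<bar> \<le> y $ j"
  shows "\<bar>avg q p x\<bar> \<le> avg q p y"
proof -
  have "x $ j \<le> y $ j" "(- x) $ j \<le> y $ j" for j
    using le[of j] by auto
  then have "avg q p x \<le> avg q p y" "avg q p (- x) \<le> avg q p y"
    by (intro avg_le[OF p]; blast)+
  then show ?thesis
    by simp
qed

lemma tendsto_avg [tendsto_intros]:
  "(f \<longlongrightarrow> x) F \<Longrightarrow> ((\<lambda>n. avg q p (f n)) \<longlongrightarrow> avg q p x) F"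
  unfolding avg_def by (intro tendsto_intros)

lemma continuous_on_avg [continuous_intros]:
  "continuous_on S f \<Longrightarrow> continuous_on S (\<lambda>n. avg q p (f n))"
  unfolding avg_def by (intro continuous_intros)

text \<open>
  With finitely many actions, positive delays are bounded away from zero.
\<close>

lemma min_delay_exists: "\<exists>\<theta>>0. \<forall>p. 0 < tau p \<longrightarrow> \<theta> \<le> tau p"
proof -
  let ?S = "insert 1 (tau ` {p. 0 < tau p})"
  have "0 < Min ?S"
    by (subst Min_gr_iff) auto
  moreover have "\<forall>p. 0 < tau p \<longrightarrow> Min ?S \<le> tau p"
    by (auto intro!: Min_le)
  ultimately show ?thesis
    by blast
qed

lemma policy_instance:
  "\<forall>q. \<sigma> q \<in> acts q \<Longrightarrow> semi_markov_decision (\<lambda>q. {\<sigma> q}) kern tau lev"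
  using lev_decreases by unfold_locales (fastforce simp: kern_nonneg kern_sum tau_nonneg)+

section \<open>The discounted problem\<close>

text \<open>
  The factor \<open>1 - a * tau p\<close> does not contract at actions without delay.  What is required here is
  that the discounted dynamics contracts at rate \<open>1 - a * \<delta>\<close> in a maximum norm with weights \<open>w\<close>; the
  bounds on the weights make this norm equivalent to the ordinary one uniformly in \<open>a\<close>.
\<close>

definition discountable :: "real \<Rightarrow> real \<Rightarrow> bool" where
  "discountable \<delta> a \<longleftrightarrow> 0 < \<delta> \<and> 0 < a \<and> (\<forall>p. a * tau p \<le> 1) \<and>
    (\<exists>w. (\<forall>q. 1 / 2 \<le> w $ q \<and> w $ q \<le> 1) \<and>
      (\<forall>q. \<forall>p\<in>acts q. (1 - a * tau p) * avg q p w \<le> (1 - a * \<delta>) * w $ q))"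

text \<open>
  Give level \<open>k\<close> the weight \<open>c ^ (L - k)\<close> with \<open>c = 1 - a * \<delta>\<close>.  An action without delay gains the factor
  \<open>c\<close> from descending one level.  An action with delay may climb up to \<open>L\<close> levels, which costs at most
  \<open>c ^ L\<close>; by Bernoulli's inequality \<open>c ^ (L + 1)\<close> is still no less than its discount factor when \<open>\<delta>\<close> is
  the least delay divided by \<open>L + 1\<close>.
\<close>

lemma discountable_exists: "\<exists>\<delta> a0. 0 < a0 \<and> (\<forall>a. 0 < a \<and> a \<le> a0 \<longrightarrow> discountable \<delta> a)"
proof -
  obtain \<theta> where \<theta>: "0 < \<theta>" "\<And>p. 0 < tau p \<Longrightarrow> \<theta> \<le> tau p"
    using min_delay_exists by blast
  define L where "L = Max (range lev)"
  have L: "lev q \<le> L" for q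
    by (simp add: L_def)
  define T where "T = Max (range tau)"
  have T: "tau p \<le> T" for p
    by (simp add: T_def)
  have T0: "0 \<le> T"
    using T tau_nonneg order_trans by blast
  define \<delta> where "\<delta> = \<theta> / (L + 1)"
  have \<delta>: "0 < \<delta>" "\<delta> * (L + 1) = \<theta>"
    using \<theta> by (simp_all add: \<delta>_def)
  have "\<delta> \<le> \<theta>"
    using \<theta> by (simp add: \<delta>_def field_simps)
  \<comment> \<open>this yields both \<open>a * T \<le> 1\<close> and \<open>a * \<theta> \<le> 1 / 2\<close>; the latter keeps the weights above one half\<close>
  define a0 where "a0 = 1 / (2 * \<theta> + T)"
  have "0 < a0"
    using \<theta> T0 by (simp add: a0_def add_pos_nonneg)
  moreover have "discountable \<delta> a" if a: "0 < a" "a \<le> a0" for a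
  proof -
    have "a * (2 * \<theta> + T) \<le> 1"
      using a \<theta> T0 by (simp add: a0_def field_simps)
    then have a': "2 * (a * \<theta>) + a * T \<le> 1"
      by (simp add: algebra_simps)
    have "0 \<le> a * T" "0 < a * \<theta>" "a * \<delta> \<le> a * \<theta>"
      using a \<theta> T0 \<open>\<delta> \<le> \<theta>\<close> by simp_all
    then have half: "a * \<theta> \<le> 1 / 2" and aT: "a * T \<le> 1" and c: "0 < 1 - a * \<delta>" "1 - a * \<delta> \<le> 1"
      using a' a \<delta> by (linarith, linarith, linarith, simp)
    have "a * tau p \<le> a * T" for p
      using T a by simp
    then have at1: "\<forall>p. a * tau p \<le> 1"
      using aT order_trans by blast
    define c where "c = 1 - a * \<delta>"
    have c01: "0 < c" "c \<le> 1"
      using c by (simp_all add: c_def)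
    have "1 + real (L + 1) * (- (a * \<delta>)) \<le> (1 + - (a * \<delta>)) ^ (L + 1)"
      using c by (intro Bernoulli_inequality) simp
    moreover have "real (L + 1) * (a * \<delta>) = a * \<theta>"
      using \<delta> by (simp add: mult.left_commute mult.commute)
    ultimately have bern: "1 - a * \<theta> \<le> c ^ (L + 1)"
      by (simp only: c_def mult_minus_right diff_conv_add_uminus)
    define w :: "real ^ 'q" where "w = (\<chi> q. c ^ (L - lev q))"
    have w1: "w $ q \<le> 1" for q
      using c01 by (simp add: w_def power_le_one)
    have wL: "c ^ L \<le> w $ q" for q
      using c01 by (simp add: w_def power_decreasing)
    have "c ^ (L + 1) \<le> c ^ L"
      using c01 by (intro power_decreasing) auto
    then have w_half: "1 / 2 \<le> w $ q" for q
      using wL[of q] bern half by linarith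
    have "(1 - a * tau p) * avg q p w \<le> c * w $ q" if p: "p \<in> acts q" for q p
    proof (cases "tau p = 0")
      case True
      have "w $ j \<le> c * w $ q" if "0 < kern q p j" for j
      proof -
        have "lev j < lev q"
          using lev_decreases[OF p True that] .
        then have "Suc (L - lev q) \<le> L - lev j"
          using L[of q] by linarith
        then have "c ^ (L - lev j) \<le> c ^ Suc (L - lev q)"
          using c01 by (intro power_decreasing) auto
        then show ?thesis
          by (simp add: w_def)
      qed
      then show ?thesis
        using avg_le_const[OF p, of w] True by simp
    next
      case False
      then have "\<theta> \<le> tau p"
        using \<theta>(2) tau_nonneg[of p] by simp
      then have "a * \<theta> \<le> a * tau p"
        using a by simp
      moreover have "avg q p w \<le> 1"
        using avg_le_const[OF p] w1 by blast
      moreover have "0 \<le> w $ j" for j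
        using w_half[of j] by linarith
      then have "0 \<le> avg q p w"
        using avg_le[OF p, of 0 w] by simp
      ultimately have "(1 - a * tau p) * avg q p w \<le> (1 - a * \<theta>) * 1"
        using half by (intro mult_mono) auto
      also have "\<dots> \<le> c * c ^ L"
        using bern by simp
      also have "\<dots> \<le> c * w $ q"
        using wL c01 by simp
      finally show ?thesis .
    qed
    then show ?thesis
      using w_half w1 \<delta>(1) a(1) at1 unfolding discountable_def c_def
      by (intro conjI exI[of _ w]) blast+
  qed
  ultimately show ?thesis
    by blast
qed

text \<open>
  Look at a state where the weighted absolute value is largest.  The bound is of order \<open>1 / a\<close>.
\<close>

lemma discounted_bound:
  assumes a: "discountable \<delta> a"
    and x: "\<And>q. \<exists>p\<in>acts q. \<bar>x $ q\<bar> \<le> K + (1 - a * tau p) * \<bar>avg q p x\<bar>"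
  shows "\<bar>x $ q\<bar> \<le> 2 * K / (a * \<delta>)"
proof -
  obtain w where w: "\<And>q. 1 / 2 \<le> w $ q" "\<And>q. w $ q \<le> 1"
    and contr: "\<And>q p. p \<in> acts q \<Longrightarrow> (1 - a * tau p) * avg q p w \<le> (1 - a * \<delta>) * w $ q"
    using a unfolding discountable_def by blast
  have pos: "0 < a * \<delta>" and at1: "\<And>p. a * tau p \<le> 1"
    using a by (simp_all add: discountable_def)
  have w0: "0 < w $ q" for q
    using w(1)[of q] by linarith
  obtain m where m: "\<And>q. \<bar>x $ q\<bar> / w $ q \<le> \<bar>x $ m\<bar> / w $ m"
    using minimizer_exists[of UNIV "\<lambda>q. - (\<bar>x $ q\<bar> / w $ q)"] by auto
  define M where "M = \<bar>x $ m\<bar> / w $ m"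
  have M0: "0 \<le> M"
    using w0[of m] by (simp add: M_def)
  have xM: "\<bar>x $ q\<bar> \<le> M * w $ q" for q
    using m[of q] w0[of q] by (simp add: M_def pos_divide_le_eq)
  obtain p where p: "p \<in> acts m" "\<bar>x $ m\<bar> \<le> K + (1 - a * tau p) * \<bar>avg m p x\<bar>"
    using x by blast
  have "\<bar>avg m p x\<bar> \<le> avg m p (M *\<^sub>R w)"
    using xM by (intro abs_avg_le[OF p(1)]) simp
  then have "(1 - a * tau p) * \<bar>avg m p x\<bar> \<le> (1 - a * tau p) * (M * avg m p w)"
    using at1[of p] by (intro mult_left_mono) simp_all
  also have "\<dots> = M * ((1 - a * tau p) * avg m p w)"
    by simp
  also have "\<dots> \<le> M * ((1 - a * \<delta>) * w $ m)"
    using contr[OF p(1)] M0 by (rule mult_left_mono)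
  finally have "M * w $ m \<le> K + M * ((1 - a * \<delta>) * w $ m)"
    using p(2) w0[of m] by (simp add: M_def)
  then have "M * (a * \<delta>) * w $ m \<le> K"
    by (simp add: algebra_simps)
  moreover have "M * (a * \<delta>) * (1 / 2) \<le> M * (a * \<delta>) * w $ m"
    using w(1)[of m] M0 pos by (intro mult_left_mono) simp_all
  ultimately have "M \<le> 2 * K / (a * \<delta>)"
    using pos by (simp add: pos_le_divide_eq)
  moreover have "M * w $ q \<le> M * 1"
    using M0 w(2) by (intro mult_left_mono)
  ultimately show ?thesis
    using xM[of q] by linarith
qed

text \<open>
  The dynamic programming operator is continuous and, by the contraction estimate, maps a box with
  sides proportional to the weights into itself; Brouwer's theorem gives a fixed point.
\<close>

lemma discounted_solution_exists:
  assumes a: "discountable \<delta> a"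
  shows "\<exists>v \<sigma>. \<forall>q. \<sigma> q \<in> acts q \<and> v $ q = r q (\<sigma> q) + (1 - a * tau (\<sigma> q)) * avg q (\<sigma> q) v \<and>
    (\<forall>p\<in>acts q. v $ q \<le> r q p + (1 - a * tau p) * avg q p v)"
proof -
  obtain w where w: "\<And>q. 1 / 2 \<le> w $ q" "\<And>q. w $ q \<le> 1"
    and contr: "\<And>q p. p \<in> acts q \<Longrightarrow> (1 - a * tau p) * avg q p w \<le> (1 - a * \<delta>) * w $ q"
    using a unfolding discountable_def by blast
  have pos: "0 < a * \<delta>" and at1: "\<And>p. a * tau p \<le> 1"
    using a by (simp_all add: discountable_def)
  define R where "R = (\<Sum>q\<in>UNIV. \<Sum>p\<in>UNIV. \<bar>r q p\<bar>)"
  have R: "\<bar>r q p\<bar> \<le> R" for q p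
  proof -
    have "\<bar>r q p\<bar> \<le> (\<Sum>p\<in>UNIV. \<bar>r q p\<bar>)"
      by (intro member_le_sum) auto
    also have "\<dots> \<le> R"
      unfolding R_def by (rule member_le_sum[where f = "\<lambda>q. \<Sum>p\<in>UNIV. \<bar>r q p\<bar>"]) (auto intro: sum_nonneg)
    finally show ?thesis .
  qed
  have R0: "0 \<le> R"
    using R[of undefined undefined] by linarith
  \<comment> \<open>twice what the contraction rate asks for, as the weights may be as small as one half\<close>
  define K where "K = 2 * R / (a * \<delta>)"
  have K0: "0 \<le> K"
    using R0 pos by (simp add: K_def)
  define G where "G v q p = r q p + (1 - a * tau p) * avg q p v" for v q p
  define f where "f v = (\<chi> q. MIN p\<in>acts q. G v q p)" for v
  let ?B = "cbox (- (K *\<^sub>R w)) (K *\<^sub>R w)"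
  have B: "v \<in> ?B \<longleftrightarrow> (\<forall>q. \<bar>v $ q\<bar> \<le> K * w $ q)" for v
    by (auto simp: mem_box_cart abs_le_iff minus_le_iff)
  have in_B: "\<bar>G v q p\<bar> \<le> K * w $ q" if v: "v \<in> ?B" and p: "p \<in> acts q" for v q p
  proof -
    have "\<bar>avg q p v\<bar> \<le> avg q p (K *\<^sub>R w)"
      using v unfolding B by (intro abs_avg_le[OF p]) simp
    then have "(1 - a * tau p) * \<bar>avg q p v\<bar> \<le> (1 - a * tau p) * (K * avg q p w)"
      using at1[of p] by (intro mult_left_mono) simp_all
    also have "\<dots> = K * ((1 - a * tau p) * avg q p w)"
      by simp
    also have "\<dots> \<le> K * ((1 - a * \<delta>) * w $ q)"
      using contr[OF p] K0 by (rule mult_left_mono)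
    finally have "(1 - a * tau p) * \<bar>avg q p v\<bar> \<le> K * w $ q - (K * (a * \<delta>)) * w $ q"
      by (simp add: algebra_simps)
    moreover have "K * (a * \<delta>) = 2 * R"
      using pos K_def by (metis less_irrefl nonzero_eq_divide_eq)
    moreover have "2 * R * (1 / 2) \<le> 2 * R * w $ q"
      using w(1)[of q] R0 by (intro mult_left_mono) simp_all
    ultimately have "(1 - a * tau p) * \<bar>avg q p v\<bar> \<le> K * w $ q - R"
      by simp
    moreover have "\<bar>G v q p\<bar> \<le> \<bar>r q p\<bar> + (1 - a * tau p) * \<bar>avg q p v\<bar>"
      using at1[of p] unfolding G_def by (metis abs_mult abs_of_nonneg abs_triangle_ineq diff_ge_0_iff_ge)
    ultimately show ?thesis
      using R[of q p] by linarith
  qed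
  have attained: "\<exists>p\<in>acts q. (MIN p\<in>acts q. G v q p) = G v q p" for v q
    using Min_in[of "G v q ` acts q"] acts_nonempty[of q] by fastforce
  have "f v \<in> ?B" if "v \<in> ?B" for v
    unfolding B
  proof
    fix q
    obtain p where "p \<in> acts q" "(MIN p\<in>acts q. G v q p) = G v q p"
      using attained by blast
    then show "\<bar>f v $ q\<bar> \<le> K * w $ q"
      using in_B[OF that] by (simp add: f_def)
  qed
  moreover have "continuous_on ?B f"
    unfolding f_def G_def
    by (intro continuous_on_vec_lambda continuous_on_Min_finite continuous_intros acts_nonempty finite)
  moreover have "0 \<in> ?B"
    using w(1) K0 by (subst B) (simp add: order_trans[OF _ w(1)])
  then have "?B \<noteq> {}"
    by blast
  ultimately obtain v where v: "f v = v"
    using brouwer[of ?B f] by (metis Pi_I compact_cbox convex_box(1))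
  have "\<exists>p. p \<in> acts q \<and> v $ q = G v q p" for q
    using attained[of q v] v by (metis f_def vec_lambda_beta)
  then obtain \<sigma> where \<sigma>: "\<And>q. \<sigma> q \<in> acts q \<and> v $ q = G v q (\<sigma> q)"
    by metis
  have "v $ q \<le> G v q p" if "p \<in> acts q" for q p
  proof -
    have "f v $ q \<le> G v q p"
      using that by (simp add: f_def)
    then show ?thesis
      using v by simp
  qed
  then show ?thesis
    using \<sigma> unfolding G_def by blast
qed

section \<open>Evaluation of a policy\<close>

text \<open>
  Let \<open>a\<close> tend to zero in the discounted value \<open>v\<close> of the policy.  The vectors \<open>a v\<close> stay bounded and
  accumulate at a harmonic \<open>g\<close>.  The discounted equation says that \<open>v - P v\<close> equals \<open>b\<close> minus \<open>tau\<close>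
  times \<open>P (a v)\<close>; the range of \<open>I - P\<close> being closed, the limit \<open>b - tau g\<close> lies in it as well.
\<close>

lemma policy_evaluation_exists:
  fixes b :: "real ^ 'q"
  assumes \<sigma>: "\<forall>q. \<sigma> q \<in> acts q"
  shows "\<exists>g u. \<forall>q. g $ q = avg q (\<sigma> q) g \<and> u $ q + tau (\<sigma> q) * g $ q = b $ q + avg q (\<sigma> q) u"
proof -
  interpret S: semi_markov_decision "\<lambda>q. {\<sigma> q}" kern tau lev
    by (rule policy_instance[OF \<sigma>])
  obtain \<delta> a0 where a0: "0 < a0" and disc: "\<And>a. 0 < a \<Longrightarrow> a \<le> a0 \<Longrightarrow> S.discountable \<delta> a"
    using S.discountable_exists by blast
  then have \<delta>: "0 < \<delta>"
    unfolding S.discountable_def by blast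
  define a where "a n = a0 / real (Suc n)" for n
  have a: "0 < a n" "a n \<le> a0" for n
    using a0 by (simp_all add: a_def divide_le_eq)
  have a_lim: "a \<longlonglongrightarrow> 0"
    unfolding a_def by (rule LIMSEQ_Suc[OF lim_const_over_n])
  have "\<exists>v. \<forall>q. v $ q = b $ q + (1 - a n * tau (\<sigma> q)) * avg q (\<sigma> q) v" for n
    using S.discounted_solution_exists[where r = "\<lambda>q _. b $ q", OF disc[OF a], of n] by (metis singletonD)
  then obtain v where v: "\<And>n q. v n $ q = b $ q + (1 - a n * tau (\<sigma> q)) * avg q (\<sigma> q) (v n)"
    by metis
  define X where "X n = a n *\<^sub>R v n" for n
  define K where "K = (\<Sum>q\<in>UNIV. \<bar>b $ q\<bar>)"
  have K: "\<bar>b $ q\<bar> \<le> K" for q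
    unfolding K_def by (rule member_le_sum) auto
  have v_le: "\<bar>v n $ q\<bar> \<le> 2 * K / (a n * \<delta>)" for n q
  proof (rule S.discounted_bound[OF disc[OF a]])
    fix q
    have "\<bar>v n $ q\<bar> \<le> \<bar>b $ q\<bar> + \<bar>(1 - a n * tau (\<sigma> q)) * avg q (\<sigma> q) (v n)\<bar>"
      unfolding v[of n q] by (rule abs_triangle_ineq)
    moreover have "0 \<le> 1 - a n * tau (\<sigma> q)"
      using disc[OF a, of n] unfolding S.discountable_def by simp
    ultimately show "\<exists>p\<in>{\<sigma> q}. \<bar>v n $ q\<bar> \<le> K + (1 - a n * tau p) * \<bar>avg q p (v n)\<bar>"
      using K[of q] by (simp add: abs_mult)
  qed
  have "\<bar>X n $ q\<bar> \<le> 2 * K / \<delta>" for n q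
  proof -
    have "a n * \<bar>v n $ q\<bar> \<le> a n * (2 * K / (a n * \<delta>))"
      using v_le[of n q] a(1)[of n] by (intro mult_left_mono) auto
    then show ?thesis
      using a(1)[of n] by (simp add: X_def abs_mult)
  qed
  then have "(\<Sum>q\<in>UNIV. \<bar>X n $ q\<bar>) \<le> (\<Sum>q\<in>(UNIV :: 'q set). 2 * K / \<delta>)" for n
    by (intro sum_mono)
  then have "norm (X n) \<le> (\<Sum>q\<in>(UNIV :: 'q set). 2 * K / \<delta>)" for n
    using norm_le_l1_cart[of "X n"] by (rule order_trans[rotated])
  then have "bounded (range X)"
    by (intro boundedI) blast
  then obtain g s where s: "strict_mono (s :: nat \<Rightarrow> nat)" and "(X \<circ> s) \<longlonglongrightarrow> g"
    using bounded_imp_convergent_subsequence by blast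
  then have X_lim: "(\<lambda>n. X (s n)) \<longlonglongrightarrow> g"
    by (simp add: o_def)
  have as_lim: "(\<lambda>n. a (s n)) \<longlonglongrightarrow> 0"
    using LIMSEQ_subseq_LIMSEQ[OF a_lim s] by (simp add: o_def)
  have harmonic: "g $ q = avg q (\<sigma> q) g" for q
  proof -
    have "X n $ q = a n * b $ q + (1 - a n * tau (\<sigma> q)) * avg q (\<sigma> q) (X n)" for n
    proof -
      have "X n $ q = a n * (b $ q + (1 - a n * tau (\<sigma> q)) * avg q (\<sigma> q) (v n))"
        unfolding X_def using v[of n q] by simp
      then show ?thesis
        by (simp add: X_def algebra_simps)
    qed
    then have "(\<lambda>n. X (s n) $ q) \<longlonglongrightarrow> 0 * b $ q + (1 - 0 * tau (\<sigma> q)) * avg q (\<sigma> q) g"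
      by (simp only:) (intro tendsto_intros as_lim X_lim)
    moreover have "(\<lambda>n. X (s n) $ q) \<longlonglongrightarrow> g $ q"
      by (intro tendsto_intros X_lim)
    ultimately show ?thesis
      by (auto dest: LIMSEQ_unique)
  qed
  define f :: "real ^ 'q \<Rightarrow> real ^ 'q" where "f u = (\<chi> q. u $ q - avg q (\<sigma> q) u)" for u
  have "linear f"
    by (rule linearI) (simp_all add: f_def vec_eq_iff algebra_simps)
  moreover have "(\<lambda>n. f (v (s n))) \<longlonglongrightarrow> (\<chi> q. b $ q - tau (\<sigma> q) * avg q (\<sigma> q) g)"
  proof (rule vec_tendstoI)
    fix q
    have "f (v n) $ q = b $ q - tau (\<sigma> q) * avg q (\<sigma> q) (X n)" for n
      unfolding f_def X_def using v[of n q] by (simp add: algebra_simps)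
    then show "(\<lambda>n. f (v (s n)) $ q) \<longlonglongrightarrow> (\<chi> q. b $ q - tau (\<sigma> q) * avg q (\<sigma> q) g) $ q"
      by (simp only: vec_lambda_beta) (intro tendsto_intros X_lim)
  qed
  ultimately have "\<exists>u. f u = (\<chi> q. b $ q - tau (\<sigma> q) * avg q (\<sigma> q) g)"
    by (rule linear_limit_in_range)
  then obtain u where "f u = (\<chi> q. b $ q - tau (\<sigma> q) * avg q (\<sigma> q) g)" ..
  then have "u $ q + tau (\<sigma> q) * g $ q = b $ q + avg q (\<sigma> q) u" for q
    using harmonic[of q] by (simp add: f_def vec_eq_iff algebra_simps)
  then show ?thesis
    using harmonic by blast
qed

text \<open>
  If \<open>(g, u)\<close> evaluates the costs \<open>b\<close>, then \<open>v - g / a - u\<close> is \<open>a\<close> times the discounted value of the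
  costs \<open>- tau P u\<close>.  Evaluating these costs by a second pair \<open>(g', u')\<close>, the remainder after
  \<open>g / a + u + g' + a u'\<close> is the discounted value of costs of order \<open>a\<^sup>2\<close>, hence of order \<open>a\<close>.  So the
  correct bias is \<open>u + g'\<close>, which solves the same equations since \<open>g'\<close> is harmonic.
\<close>

lemma discounted_expansion:
  fixes b :: "real ^ 'q"
  assumes \<sigma>: "\<forall>q. \<sigma> q \<in> acts q"
  shows "\<exists>g u. (\<forall>q. g $ q = avg q (\<sigma> q) g \<and> u $ q + tau (\<sigma> q) * g $ q = b $ q + avg q (\<sigma> q) u) \<and>
    (\<forall>\<delta>. \<exists>C. \<forall>a v. discountable \<delta> a \<and> (\<forall>q. v $ q = b $ q + (1 - a * tau (\<sigma> q)) * avg q (\<sigma> q) v) \<longrightarrow>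
      (\<forall>q. \<bar>v $ q - g $ q / a - u $ q\<bar> \<le> C * a))"
proof -
  obtain g u where g: "\<And>q. g $ q = avg q (\<sigma> q) g"
    and u: "\<And>q. u $ q + tau (\<sigma> q) * g $ q = b $ q + avg q (\<sigma> q) u"
    using policy_evaluation_exists[OF \<sigma>, of b] by blast
  obtain g' u' where g': "\<And>q. g' $ q = avg q (\<sigma> q) g'"
    and u': "\<And>q. u' $ q + tau (\<sigma> q) * g' $ q = - tau (\<sigma> q) * avg q (\<sigma> q) u + avg q (\<sigma> q) u'"
    using policy_evaluation_exists[OF \<sigma>, of "\<chi> q. - tau (\<sigma> q) * avg q (\<sigma> q) u"]
    unfolding vec_lambda_beta by blast
  define K where "K = (\<Sum>q\<in>UNIV. \<bar>tau (\<sigma> q) * avg q (\<sigma> q) u'\<bar>)"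
  have K: "\<bar>tau (\<sigma> q) * avg q (\<sigma> q) u'\<bar> \<le> K" for q
    unfolding K_def by (rule member_le_sum) auto
  define K' where "K' = (\<Sum>q\<in>UNIV. \<bar>u' $ q\<bar>)"
  have K': "\<bar>u' $ q\<bar> \<le> K'" for q
    unfolding K'_def by (rule member_le_sum) auto
  have "\<bar>v $ q - g $ q / a - (u + g') $ q\<bar> \<le> (2 * K / \<delta> + K') * a"
    if disc: "discountable \<delta> a" and v: "\<And>q. v $ q = b $ q + (1 - a * tau (\<sigma> q)) * avg q (\<sigma> q) v"
    for \<delta> a v q
  proof -
    have a: "0 < a" "0 < \<delta>" "\<And>p. a * tau p \<le> 1"
      using disc by (simp_all add: discountable_def)
    define x where "x = v - (1 / a) *\<^sub>R g - u - g' - a *\<^sub>R u'"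
    have x: "x $ q = - (a^2) * (tau (\<sigma> q) * avg q (\<sigma> q) u') + (1 - a * tau (\<sigma> q)) * avg q (\<sigma> q) x" for q
    proof -
      let ?t = "tau (\<sigma> q)"
      let ?A = "avg q (\<sigma> q)"
      have Ag: "?A g = g $ q" and Ag': "?A g' = g' $ q"
        using g g' by simp_all
      have Au: "?A u = u $ q + ?t * g $ q - b $ q"
        using u[of q] by simp
      have Au': "?A u' = u' $ q + ?t * g' $ q + ?t * ?A u"
        using u'[of q] by simp
      have "(1 - a * ?t) * ?A x = (1 - a * ?t) * ?A v -
          (1 - a * ?t) * (g $ q / a + ?A u + g' $ q + a * ?A u')"
        unfolding x_def by (simp add: Ag Ag' algebra_simps)
      also have "(1 - a * ?t) * ?A v = v $ q - b $ q"
        using v[of q] by simp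
      also have "(1 - a * ?t) * (g $ q / a + ?A u + g' $ q + a * ?A u') =
          g $ q / a - ?t * g $ q + ?A u - a * (?t * ?A u) + g' $ q - a * (?t * g' $ q)
          + a * ?A u' - (a^2) * (?t * ?A u')"
        using a by (simp add: field_simps power2_eq_square)
      also have "a * ?A u' = a * u' $ q + a * (?t * g' $ q) + a * (?t * ?A u)"
        by (subst Au') (simp add: algebra_simps)
      finally show ?thesis
        by (simp add: x_def Au)
    qed
    have x_le: "\<bar>x $ q\<bar> \<le> 2 * (a^2 * K) / (a * \<delta>)" for q
    proof (rule discounted_bound[OF disc])
      fix q
      have "\<bar>x $ q\<bar> \<le> \<bar>- (a^2) * (tau (\<sigma> q) * avg q (\<sigma> q) u')\<bar> + \<bar>(1 - a * tau (\<sigma> q)) * avg q (\<sigma> q) x\<bar>"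
        unfolding x[of q] by (rule abs_triangle_ineq)
      also have "\<bar>- (a^2) * (tau (\<sigma> q) * avg q (\<sigma> q) u')\<bar> = a^2 * \<bar>tau (\<sigma> q) * avg q (\<sigma> q) u'\<bar>"
        by (simp add: abs_mult)
      also have "\<dots> \<le> a^2 * K"
        using K[of q] by (intro mult_left_mono) auto
      also have "\<bar>(1 - a * tau (\<sigma> q)) * avg q (\<sigma> q) x\<bar> = (1 - a * tau (\<sigma> q)) * \<bar>avg q (\<sigma> q) x\<bar>"
        using a(3)[of "\<sigma> q"] by (simp add: abs_mult)
      finally show "\<exists>p\<in>acts q. \<bar>x $ q\<bar> \<le> a^2 * K + (1 - a * tau p) * \<bar>avg q p x\<bar>"
        using \<sigma> by auto
    qed
    have "v $ q - g $ q / a - (u + g') $ q = x $ q + a * u' $ q"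
      by (simp add: x_def)
    moreover have "\<bar>a * u' $ q\<bar> \<le> a * K'"
      using a K'[of q] by (simp add: abs_mult)
    moreover have "2 * (a^2 * K) / (a * \<delta>) = 2 * K / \<delta> * a"
      using a by (simp add: power2_eq_square)
    ultimately show ?thesis
      using x_le[of q] abs_triangle_ineq[of "x $ q" "a * u' $ q"] by (simp add: algebra_simps)
  qed
  moreover have "(u + g') $ q + tau (\<sigma> q) * g $ q = b $ q + avg q (\<sigma> q) (u + g')" for q
    using u[of q] g'[of q] by simp
  ultimately show ?thesis
    using g by (intro exI[of _ g] exI[of _ "u + g'"] conjI allI) blast+
qed

section \<open>The multichain optimality equations\<close>

text \<open>
  Take a policy that is optimal for infinitely many discount rates \<open>a\<close> tending to zero.  Insert the
  expansion of its value into the discounted inequalities: at order \<open>1 / a\<close> they bound the gain, and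
  where that bound is attained the next order bounds the bias.
\<close>

theorem optimality_equations:
  fixes r :: "'q \<Rightarrow> 'p \<Rightarrow> real"
  shows "\<exists>g u \<sigma>. (\<forall>q. \<sigma> q \<in> acts q \<and> g $ q = avg q (\<sigma> q) g \<and>
      u $ q + tau (\<sigma> q) * g $ q = r q (\<sigma> q) + avg q (\<sigma> q) u) \<and>
    (\<forall>q. \<forall>p\<in>acts q. g $ q \<le> avg q p g \<and>
      (g $ q = avg q p g \<longrightarrow> u $ q + tau p * g $ q \<le> r q p + avg q p u))"
proof -
  obtain \<delta> a0 where a0: "0 < a0" and disc: "\<And>a. 0 < a \<Longrightarrow> a \<le> a0 \<Longrightarrow> discountable \<delta> a"
    using discountable_exists by blast
  define a where "a n = a0 / real (Suc n)" for n
  have a: "0 < a n" "a n \<le> a0" for n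
    using a0 by (simp_all add: a_def divide_le_eq)
  have a_lim: "a \<longlonglongrightarrow> 0"
    unfolding a_def by (rule LIMSEQ_Suc[OF lim_const_over_n])
  have "\<exists>v \<sigma>. \<forall>q. \<sigma> q \<in> acts q \<and> v $ q = r q (\<sigma> q) + (1 - a n * tau (\<sigma> q)) * avg q (\<sigma> q) v \<and>
      (\<forall>p\<in>acts q. v $ q \<le> r q p + (1 - a n * tau p) * avg q p v)" for n
    by (rule discounted_solution_exists[OF disc[OF a]])
  then obtain v s where s: "\<And>n q. s n q \<in> acts q"
    and v: "\<And>n q. v n $ q = r q (s n q) + (1 - a n * tau (s n q)) * avg q (s n q) (v n)"
    and v_le: "\<And>n q p. p \<in> acts q \<Longrightarrow> v n $ q \<le> r q p + (1 - a n * tau p) * avg q p (v n)"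
    by metis
  \<comment> \<open>some policy is optimal for infinitely many of the discount rates\<close>
  have "finite (range s)"
    by (rule finite_subset[of _ UNIV]) simp_all
  then obtain m where inf: "infinite {n. s n = s m}"
    using pigeonhole_infinite[of UNIV s] by auto
  define \<sigma> where "\<sigma> = s m"
  have \<sigma>: "\<forall>q. \<sigma> q \<in> acts q"
    using s by (simp add: \<sigma>_def)
  have freq: "\<exists>\<^sub>F n in sequentially. s n = \<sigma>"
    using inf by (simp add: \<sigma>_def frequently_cofinite flip: cofinite_eq_sequentially)
  obtain g u C where eqs: "\<And>q. g $ q = avg q (\<sigma> q) g \<and> u $ q + tau (\<sigma> q) * g $ q = r q (\<sigma> q) + avg q (\<sigma> q) u"
    and exp: "\<And>a v q. discountable \<delta> a \<Longrightarrow> (\<And>q. v $ q = r q (\<sigma> q) + (1 - a * tau (\<sigma> q)) * avg q (\<sigma> q) v) \<Longrightarrow>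
      \<bar>v $ q - g $ q / a - u $ q\<bar> \<le> C * a"
    using discounted_expansion[OF \<sigma>, of "\<chi> q. r q (\<sigma> q)"] unfolding vec_lambda_beta by blast
  have "g $ q \<le> avg q p g \<and> (g $ q = avg q p g \<longrightarrow> u $ q + tau p * g $ q \<le> r q p + avg q p u)"
    if p: "p \<in> acts q" for q p
  proof -
    \<comment> \<open>the coefficients of \<open>a n\<close> and of its square, once the discounted inequality is multiplied by \<open>a n\<close>\<close>
    define y where "y = r q p - tau p * avg q p g + avg q p u - u $ q"
    define z where "z = 2 * C - tau p * avg q p u"
    have "\<exists>\<^sub>F n in sequentially. 0 \<le> (avg q p g - g $ q) + a n * y + (a n)^2 * z"
      using freq
    proof (rule frequently_elim1)
      fix n assume "s n = \<sigma>"
      then have bound: "\<bar>v n $ j - g $ j / a n - u $ j\<bar> \<le> C * a n" for j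
        using exp[OF disc[OF a], of "v n" n] v by simp
      have t: "0 \<le> a n * tau p" "a n * tau p \<le> 1"
        using disc[OF a, of n] a[of n] tau_nonneg[of p] by (simp_all add: discountable_def)
      have Ca: "0 \<le> C * a n"
        using bound[of q] by linarith
      have "avg q p (v n) \<le> avg q p ((1 / a n) *\<^sub>R g + u + vec (C * a n))"
        using bound by (intro avg_le[OF p]) (simp add: abs_le_iff algebra_simps)
      then have "avg q p (v n) \<le> avg q p g / a n + avg q p u + C * a n"
        using p by simp
      then have "(1 - a n * tau p) * avg q p (v n) \<le>
          (1 - a n * tau p) * (avg q p g / a n + avg q p u + C * a n)"
        using t by (intro mult_left_mono) auto
      also have "\<dots> = (1 - a n * tau p) * (avg q p g / a n + avg q p u) + (1 - a n * tau p) * (C * a n)"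
        by (rule distrib_left)
      also have "(1 - a n * tau p) * (C * a n) \<le> 1 * (C * a n)"
        using t Ca by (intro mult_right_mono) auto
      finally have "g $ q / a n + u $ q - C * a n \<le>
          r q p + (1 - a n * tau p) * (avg q p g / a n + avg q p u) + C * a n"
        using v_le[OF p, of n] bound[of q] by linarith
      then have "0 \<le> a n * (r q p + (1 - a n * tau p) * (avg q p g / a n + avg q p u) + 2 * (C * a n)
          - g $ q / a n - u $ q)"
        using a[of n] by (intro mult_nonneg_nonneg) auto
      also have "\<dots> = (avg q p g - g $ q) + a n * y + (a n)^2 * z"
        using a(1)[of n] by (simp add: y_def z_def field_simps power2_eq_square)
      finally show "0 \<le> (avg q p g - g $ q) + a n * y + (a n)^2 * z" .
    qed
    from frequently_quadratic_nonneg[OF a_lim a(1) this] show ?thesis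
      by (auto simp: y_def)
  qed
  then show ?thesis
    using \<sigma> eqs by blast
qed

section \<open>Runs of the process in continuous time\<close>

text \<open>
  The value at \<open>(t, q)\<close> is computed from those at its predecessors in this relation.
\<close>

definition feeds :: "((real \<times> 'q) \<times> (real \<times> 'q)) set" where
  "feeds = {((s, j), (t, q)). 0 < t \<and> (\<exists>p\<in>acts q. s = t - tau p \<and> 0 < kern q p j)}"

text \<open>
  A jump with delay lowers the time, measured in multiples of the least positive delay; a jump
  without delay lowers the level.
\<close>

lemma wf_feeds: "wf feeds"
proof -
  obtain \<theta> where \<theta>: "0 < \<theta>" "\<And>p. 0 < tau p \<Longrightarrow> \<theta> \<le> tau p"
    using min_delay_exists by blast
  let ?m = "\<lambda>(t, q). nat \<lceil>t / \<theta>\<rceil> :: nat"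
  have "feeds \<subseteq> measures [?m, \<lambda>(t, q). lev q]"
  proof
    fix z assume "z \<in> feeds"
    then obtain t q p j where z: "z = ((t - tau p, j), (t, q))"
      and t: "0 < t" and p: "p \<in> acts q" "0 < kern q p j"
      by (auto simp: feeds_def)
    show "z \<in> measures [?m, \<lambda>(t, q). lev q]"
    proof (cases "tau p = 0")
      case True
      then show ?thesis
        using lev_decreases p by (simp add: z)
    next
      case False
      then have "\<theta> \<le> tau p"
        using \<theta> tau_nonneg[of p] by simp
      then have "(t - tau p) / \<theta> \<le> t / \<theta> - 1"
        using \<theta>(1) by (simp add: field_simps)
      then have "\<lceil>(t - tau p) / \<theta>\<rceil> \<le> \<lceil>t / \<theta>\<rceil> - 1"
        by (metis ceiling_diff_one ceiling_mono)
      moreover have "0 < \<lceil>t / \<theta>\<rceil>"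
        using t \<theta>(1) by simp
      ultimately have "nat \<lceil>(t - tau p) / \<theta>\<rceil> < nat \<lceil>t / \<theta>\<rceil>"
        by linarith
      then show ?thesis
        by (simp add: z)
    qed
  qed
  then show ?thesis
    by (rule wf_subset[OF wf_measures])
qed

text \<open>
  Well-founded induction: an average of values that are at most \<open>C\<close> is at most \<open>C\<close>.
\<close>

lemma maximum_principle:
  fixes d :: "real \<Rightarrow> real ^ 'q"
  assumes step: "\<And>t q. t0 < t \<Longrightarrow> \<exists>p\<in>acts q. d t $ q \<le> avg q p (d (t - tau p))"
    and init: "\<And>t q. t0 - T \<le> t \<Longrightarrow> t \<le> t0 \<Longrightarrow> d t $ q \<le> C"
    and T: "\<And>p. tau p \<le> T" and t: "t0 - T \<le> t"
  shows "d t $ q \<le> C"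
proof -
  have "- T \<le> fst tq \<longrightarrow> d (t0 + fst tq) $ snd tq \<le> C" for tq
    using wf_feeds
  proof (induction tq rule: wf_induct_rule)
    case (less tq)
    obtain t q where tq: "tq = (t, q)"
      by (cases tq)
    show ?case
    proof (cases "0 < t")
      case True
      then obtain p where p: "p \<in> acts q" "d (t0 + t) $ q \<le> avg q p (d (t0 + t - tau p))"
        using step[of "t0 + t"] by auto
      have "d (t0 + t - tau p) $ j \<le> C" if "0 < kern q p j" for j
        using less[of "(t - tau p, j)"] p(1) that True T[of p] by (auto simp: feeds_def tq algebra_simps)
      then show ?thesis
        using p avg_le_const[OF p(1)] by (auto simp: tq intro: order_trans)
    next
      case False
      then show ?thesis
        using init[of "t0 + t" q] by (simp add: tq)
    qed
  qed
  from this[of "(t - t0, q)"] show ?thesis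
    using t by simp
qed

definition is_run :: "('q \<Rightarrow> 'p \<Rightarrow> real) \<Rightarrow> (real \<Rightarrow> real ^ 'q) \<Rightarrow> bool" where
  "is_run r x \<longleftrightarrow> (\<forall>t>0. \<forall>q. x t $ q = (MIN p\<in>acts q. r q p + avg q p (x (t - tau p))))"

lemma run_exists: "\<exists>x. is_run r x \<and> (\<forall>t\<le>0. x t = 0)"
proof -
  define H :: "(real \<times> 'q \<Rightarrow> real) \<Rightarrow> real \<times> 'q \<Rightarrow> real" where
    "H f = (\<lambda>(t, q). if 0 < t then MIN p\<in>acts q. r q p + (\<Sum>j\<in>UNIV. kern q p j * f (t - tau p, j)) else 0)" for f
  have "adm_wf feeds H"
    unfolding adm_wf_def
  proof (intro allI impI)
    fix f f' :: "real \<times> 'q \<Rightarrow> real" and tq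
    assume eq: "\<forall>z. (z, tq) \<in> feeds \<longrightarrow> f z = f' z"
    obtain t q where tq: "tq = (t, q)"
      by (cases tq)
    have "(\<Sum>j\<in>UNIV. kern q p j * f (t - tau p, j)) = (\<Sum>j\<in>UNIV. kern q p j * f' (t - tau p, j))"
      if "0 < t" "p \<in> acts q" for p
    proof (rule sum.cong)
      fix j
      have "f (t - tau p, j) = f' (t - tau p, j)" if "0 < kern q p j"
        using eq that \<open>0 < t\<close> \<open>p \<in> acts q\<close> by (auto simp: feeds_def tq)
      then show "kern q p j * f (t - tau p, j) = kern q p j * f' (t - tau p, j)"
        using kern_nonneg[OF \<open>p \<in> acts q\<close>, of j] by (cases "kern q p j = 0") auto
    qed simp
    then show "H f tq = H f' tq"
      by (auto simp: H_def tq intro!: arg_cong[of _ _ Min] image_cong)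
  qed
  then have fixpoint: "wfrec feeds H = H (wfrec feeds H)"
    by (rule wfrec_fixpoint[OF wf_feeds])
  define x :: "real \<Rightarrow> real ^ 'q" where "x t = (\<chi> q. wfrec feeds H (t, q))" for t
  have "x t $ q = H (wfrec feeds H) (t, q)" for t q
    unfolding x_def vec_lambda_beta by (rule fun_cong[OF fixpoint])
  then have "x t $ q = (if 0 < t then MIN p\<in>acts q. r q p + avg q p (x (t - tau p)) else 0)" for t q
    by (simp add: H_def x_def avg_def)
  then have "is_run r x \<and> (\<forall>t\<le>0. x t = 0)"
    by (simp add: is_run_def vec_eq_iff)
  then show ?thesis
    by blast
qed

lemma run_le:
  assumes "is_run r x" "0 < t" "p \<in> acts q"
  shows "x t $ q \<le> r q p + avg q p (x (t - tau p))"
  using assms by (simp add: is_run_def)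

lemma run_attained:
  assumes "is_run r x" "0 < t"
  shows "\<exists>p\<in>acts q. x t $ q = r q p + avg q p (x (t - tau p))"
proof -
  have "x t $ q \<in> (\<lambda>p. r q p + avg q p (x (t - tau p))) ` acts q"
    using assms acts_nonempty[of q] Min_in[of "(\<lambda>p. r q p + avg q p (x (t - tau p))) ` acts q"]
    by (simp add: is_run_def)
  then show ?thesis
    by auto
qed

text \<open>
  Along the fixed policy the line is an exact solution, whereas the minimum can only lower the run;
  the maximum principle applies to the difference.
\<close>

lemma run_below_policy_line:
  assumes x: "is_run r x" and T: "\<And>p. tau p \<le> T"
    and init: "\<And>t q. - T \<le> t \<Longrightarrow> t \<le> 0 \<Longrightarrow> \<bar>x t $ q\<bar> \<le> B"
    and \<sigma>: "\<And>q. \<sigma> q \<in> acts q"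
    and g: "\<And>q. g $ q = avg q (\<sigma> q) g"
    and u: "\<And>q. u $ q + tau (\<sigma> q) * g $ q = r q (\<sigma> q) + avg q (\<sigma> q) u"
  shows "\<exists>C. \<forall>t\<ge>0. \<forall>q. x t $ q \<le> t * g $ q + C"
proof -
  have T0: "0 \<le> T"
    using T tau_nonneg order_trans by blast
  define Kg where "Kg = (\<Sum>q\<in>UNIV. \<bar>g $ q\<bar>)"
  have Kg: "\<bar>g $ q\<bar> \<le> Kg" for q
    unfolding Kg_def by (rule member_le_sum) auto
  define Ku where "Ku = (\<Sum>q\<in>UNIV. \<bar>u $ q\<bar>)"
  have Ku: "\<bar>u $ q\<bar> \<le> Ku" for q
    unfolding Ku_def by (rule member_le_sum) auto
  define d where "d t = x t - u - t *\<^sub>R g" for t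
  define C where "C = B + Ku + T * Kg"
  have d: "d t $ q \<le> C" if "0 - T \<le> t" for t q
  proof (rule maximum_principle[OF _ _ T that])
    fix t q assume t: "(0::real) < t"
    have "d t $ q \<le> r q (\<sigma> q) + avg q (\<sigma> q) (x (t - tau (\<sigma> q))) - u $ q - t * g $ q"
      using run_le[OF x t \<sigma>, of q] by (simp add: d_def)
    also have "\<dots> = avg q (\<sigma> q) (d (t - tau (\<sigma> q)))"
      using u[of q] g[of q] by (simp add: d_def algebra_simps)
    finally show "\<exists>p\<in>acts q. d t $ q \<le> avg q p (d (t - tau p))"
      using \<sigma> by blast
  next
    fix t q assume t: "0 - T \<le> t" "t \<le> 0"
    have "\<bar>t * g $ q\<bar> \<le> T * Kg"
      unfolding abs_mult using t Kg[of q] T0 by (intro mult_mono) auto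
    then show "d t $ q \<le> C"
      using init[of t q] Ku[of q] t by (simp add: d_def C_def)
  qed
  have "x t $ q \<le> t * g $ q + (C + Ku)" if "0 \<le> t" for t q
  proof -
    have "0 - T \<le> t"
      using that T0 by simp
    from d[OF this, of q] show ?thesis
      using Ku[of q] by (simp add: d_def)
  qed
  then show ?thesis
    by blast
qed

text \<open>
  A run stays bounded below because costs are nonnegative; this makes the maximum principle
  applicable from a late time on, when the line is a subsolution for all actions.
\<close>

lemma run_above_subsolution:
  assumes x: "is_run r x" and T: "\<And>p. tau p \<le> T" and r: "\<And>q p. p \<in> acts q \<Longrightarrow> 0 \<le> r q p"
    and init: "\<And>t q. - T \<le> t \<Longrightarrow> t \<le> 0 \<Longrightarrow> \<bar>x t $ q\<bar> \<le> B"
    and g: "\<And>q p. p \<in> acts q \<Longrightarrow> g $ q \<le> avg q p g"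
    and u: "\<And>q p. p \<in> acts q \<Longrightarrow> g $ q = avg q p g \<Longrightarrow> u $ q + tau p * g $ q \<le> r q p + avg q p u"
  shows "\<exists>C t1. \<forall>t\<ge>t1. \<forall>q. t * g $ q - C \<le> x t $ q"
proof -
  have T0: "0 \<le> T"
    using T tau_nonneg order_trans by blast
  define Kg where "Kg = (\<Sum>q\<in>UNIV. \<bar>g $ q\<bar>)"
  have Kg: "\<bar>g $ q\<bar> \<le> Kg" for q
    unfolding Kg_def by (rule member_le_sum) auto
  define Ku where "Ku = (\<Sum>q\<in>UNIV. \<bar>u $ q\<bar>)"
  have Ku: "\<bar>u $ q\<bar> \<le> Ku" for q
    unfolding Ku_def by (rule member_le_sum) auto
  \<comment> \<open>the initial lower bound persists, by the maximum principle for \<open>- x\<close>\<close>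
  have below: "(- x t) $ q \<le> B" if "0 - T \<le> t" for t q
  proof (rule maximum_principle[OF _ _ T that])
    fix t q assume t: "(0::real) < t"
    obtain p where p: "p \<in> acts q" "x t $ q = r q p + avg q p (x (t - tau p))"
      using run_attained[OF x t] by blast
    then show "\<exists>p\<in>acts q. (- x t) $ q \<le> avg q p (- x (t - tau p))"
      using r[OF p(1)] by (intro bexI[of _ p]) auto
  next
    fix t q assume "0 - T \<le> t" "t \<le> (0::real)"
    then show "(- x t) $ q \<le> B"
      using init[of t q] by simp
  qed
  have "\<forall>\<^sub>F t in at_top. \<forall>q. \<forall>p\<in>acts q.
      u $ q + t * g $ q \<le> r q p + avg q p (u + (t - tau p) *\<^sub>R g)"
  proof (intro eventually_all_finite eventually_ball_finite ballI finite)
    fix q p assume p: "p \<in> acts q"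
    show "\<forall>\<^sub>F t in at_top. u $ q + t * g $ q \<le> r q p + avg q p (u + (t - tau p) *\<^sub>R g)"
    proof (cases "g $ q = avg q p g")
      case True
      then have "u $ q + t * g $ q \<le> r q p + avg q p (u + (t - tau p) *\<^sub>R g)" for t
        using u[OF p True] by (simp add: algebra_simps)
      then show ?thesis
        by simp
    next
      case False
      define c where "c = avg q p g - g $ q"
      have c: "0 < c"
        using False g[OF p] by (simp add: c_def)
      define b where "b = r q p + avg q p u - tau p * avg q p g - u $ q"
      show ?thesis
        using eventually_ge_at_top[of "- b / c"]
      proof (rule eventually_mono)
        fix t assume "- b / c \<le> t"
        then have "0 \<le> b + t * c"
          using c by (simp add: field_simps)
        then show "u $ q + t * g $ q \<le> r q p + avg q p (u + (t - tau p) *\<^sub>R g)"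
          by (simp add: b_def c_def algebra_simps)
      qed
    qed
  qed
  then obtain t2 where t2: "\<And>t q p. t2 \<le> t \<Longrightarrow> p \<in> acts q \<Longrightarrow>
      u $ q + t * g $ q \<le> r q p + avg q p (u + (t - tau p) *\<^sub>R g)"
    unfolding eventually_at_top_linorder by blast
  \<comment> \<open>\<open>x\<close> obeys the dynamics at positive times only\<close>
  define t1 where "t1 = max 0 t2"
  define d where "d t = u + t *\<^sub>R g - x t" for t
  define C where "C = Ku + (t1 + T) * Kg + B"
  have d: "d t $ q \<le> C" if "t1 - T \<le> t" for t q
  proof (rule maximum_principle[OF _ _ T that])
    fix t q assume t: "t1 < t"
    then have "0 < t" "t2 \<le> t"
      by (simp_all add: t1_def)
    obtain p where p: "p \<in> acts q" "x t $ q = r q p + avg q p (x (t - tau p))"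
      using run_attained[OF x \<open>0 < t\<close>] by blast
    have "d t $ q \<le> avg q p (d (t - tau p))"
      using t2[OF \<open>t2 \<le> t\<close> p(1)] p(2) by (simp add: d_def)
    then show "\<exists>p\<in>acts q. d t $ q \<le> avg q p (d (t - tau p))"
      using p(1) by blast
  next
    fix t q assume t: "t1 - T \<le> t" "t \<le> t1"
    have "0 \<le> t1"
      by (simp add: t1_def)
    have "\<bar>t * g $ q\<bar> \<le> (t1 + T) * Kg"
      unfolding abs_mult using t Kg[of q] T0 \<open>0 \<le> t1\<close> by (intro mult_mono) auto
    then show "d t $ q \<le> C"
      using below[of t q] Ku[of q] t \<open>0 \<le> t1\<close> by (simp add: d_def C_def)
  qed
  have "t * g $ q - (C + Ku) \<le> x t $ q" if "t1 \<le> t" for t q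
  proof -
    have "t1 - T \<le> t"
      using that T0 by simp
    from d[OF this, of q] show ?thesis
      using Ku[of q] by (simp add: d_def)
  qed
  then show ?thesis
    by blast
qed

section \<open>The gain of a policy and the growth rate of runs\<close>

definition kernel_matrix :: "('q \<Rightarrow> 'p) \<Rightarrow> real ^ 'q ^ 'q" where
  "kernel_matrix \<sigma> = (\<chi> q j. kern q (\<sigma> q) j)"

lemma kernel_matrix_mult: "(kernel_matrix \<sigma> *v x) $ q = avg q (\<sigma> q) x"
  by (simp add: kernel_matrix_def matrix_vector_mult_def avg_def)

lemma stochastic_kernel_matrix: "\<forall>q. \<sigma> q \<in> acts q \<Longrightarrow> stochastic (kernel_matrix \<sigma>)"
  by (simp add: stochastic_def kernel_matrix_def kern_nonneg kern_sum)

text \<open>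
  A state of lowest level in the class has a successor in the class, which is not of lower level;
  hence the delay there is positive.
\<close>

lemma mean_holding_positive:
  assumes \<sigma>: "\<forall>q. \<sigma> q \<in> acts q" and F: "F \<in> final_classes (kernel_matrix \<sigma>)"
  shows "0 < invariant_measure (kernel_matrix \<sigma>) F \<bullet> (\<chi> q. tau (\<sigma> q))"
proof -
  let ?P = "kernel_matrix \<sigma>"
  have P: "stochastic ?P"
    by (rule stochastic_kernel_matrix[OF \<sigma>])
  have \<mu>: "invariant_measure_on ?P F (invariant_measure ?P F)"
    by (rule invariant_measure_on_invariant_measure[OF P F])
  obtain q where q: "q \<in> F" "\<And>j. j \<in> F \<Longrightarrow> lev q \<le> lev j"
    using minimizer_exists[OF finite final_class_nonempty[OF F], of lev] by auto
  have "\<exists>j. kern q (\<sigma> q) j \<noteq> 0"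
    using kern_sum[of "\<sigma> q" q] \<sigma> by (metis sum.neutral zero_neq_one)
  then obtain j where j: "0 < kern q (\<sigma> q) j"
    using kern_nonneg[of "\<sigma> q" q] \<sigma> by (metis order_le_less)
  then have "j \<in> F"
    using final_class_no_exit[OF P F q(1), of j] by (auto simp: kernel_matrix_def)
  then have "tau (\<sigma> q) \<noteq> 0"
    using lev_decreases[of "\<sigma> q" q j] \<sigma> j q(2)[of j] by auto
  then have "0 < invariant_measure ?P F $ q * tau (\<sigma> q)"
    using invariant_measure_positive[OF P F \<mu> q(1)] tau_nonneg[of "\<sigma> q"] by simp
  also have "\<dots> \<le> (\<Sum>j\<in>UNIV. invariant_measure ?P F $ j * tau (\<sigma> j))"
    using \<mu> tau_nonneg
    by (intro member_le_sum[where f = "\<lambda>j. invariant_measure ?P F $ j * tau (\<sigma> j)"])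
      (auto simp: invariant_measure_on_def)
  finally show ?thesis
    by (simp add: inner_vec_def)
qed

definition policy_gain :: "('q \<Rightarrow> 'p \<Rightarrow> real) \<Rightarrow> ('q \<Rightarrow> 'p) \<Rightarrow> 'q \<Rightarrow> real" where
  "policy_gain r \<sigma> q = (\<Sum>F\<in>final_classes (kernel_matrix \<sigma>).
     reach_prob (kernel_matrix \<sigma>) F q *
     (invariant_measure (kernel_matrix \<sigma>) F \<bullet> (\<chi> q. r q (\<sigma> q)) /
      (invariant_measure (kernel_matrix \<sigma>) F \<bullet> (\<chi> q. tau (\<sigma> q)))))"

text \<open>
  In particular all solutions of the evaluation equations have the same gain.
\<close>

lemma gain_eq_policy_gain:
  assumes eqs: "\<And>q. \<sigma> q \<in> acts q \<and> g $ q = avg q (\<sigma> q) g \<and>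
    u $ q + tau (\<sigma> q) * g $ q = r q (\<sigma> q) + avg q (\<sigma> q) u"
  shows "g $ q = policy_gain r \<sigma> q"
  unfolding policy_gain_def
proof (rule gain_eq_ergodic_average)
  have \<sigma>: "\<forall>q. \<sigma> q \<in> acts q"
    using eqs by blast
  then show "stochastic (kernel_matrix \<sigma>)"
    by (rule stochastic_kernel_matrix)
  show "kernel_matrix \<sigma> *v g = g"
    using eqs by (simp add: vec_eq_iff kernel_matrix_mult)
  show "u $ i + (\<chi> q. tau (\<sigma> q)) $ i * g $ i = (\<chi> q. r q (\<sigma> q)) $ i + (kernel_matrix \<sigma> *v u) $ i" for i
    using eqs[of i] unfolding vec_lambda_beta kernel_matrix_mult by blast
  show "0 < invariant_measure (kernel_matrix \<sigma>) F \<bullet> (\<chi> q. tau (\<sigma> q))"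
    if "F \<in> final_classes (kernel_matrix \<sigma>)" for F
    by (rule mean_holding_positive[OF \<sigma> that])
qed

text \<open>
  The gain of the optimality equations is the growth rate of every run, it is the gain of an optimal
  policy, and it is at most the gain of any other policy because the run from zero lies below the
  corresponding line.
\<close>

theorem run_growth_rate_formula:
  assumes r: "\<And>q p. p \<in> acts q \<Longrightarrow> 0 \<le> r q p" and T: "\<And>p. tau p \<le> T"
    and x: "is_run r x" and init: "\<And>t q. - T \<le> t \<Longrightarrow> t \<le> 0 \<Longrightarrow> \<bar>x t $ q\<bar> \<le> B"
  shows "((\<lambda>t. x t $ q / t) \<longlongrightarrow> (MIN \<sigma>\<in>{\<sigma>. \<forall>q. \<sigma> q \<in> acts q}. policy_gain r \<sigma> q)) at_top"
proof -
  obtain g u0 \<sigma>0 where eqs: "\<And>q. \<sigma>0 q \<in> acts q \<and> g $ q = avg q (\<sigma>0 q) g \<and>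
      u0 $ q + tau (\<sigma>0 q) * g $ q = r q (\<sigma>0 q) + avg q (\<sigma>0 q) u0"
    and sub: "\<And>q p. p \<in> acts q \<Longrightarrow> g $ q \<le> avg q p g \<and>
      (g $ q = avg q p g \<longrightarrow> u0 $ q + tau p * g $ q \<le> r q p + avg q p u0)"
    using optimality_equations[of r] by blast
  have rate: "((\<lambda>t. x t $ q / t) \<longlongrightarrow> g $ q) at_top"
    if x: "is_run r x" and init: "\<And>t q. - T \<le> t \<Longrightarrow> t \<le> 0 \<Longrightarrow> \<bar>x t $ q\<bar> \<le> B" for x B q
  proof -
    obtain C where "\<And>t q. 0 \<le> t \<Longrightarrow> x t $ q \<le> t * g $ q + C"
      using run_below_policy_line[OF x T init, of \<sigma>0 g u0] eqs by blast
    moreover obtain C' t1 where "\<And>t q. t1 \<le> t \<Longrightarrow> t * g $ q - C' \<le> x t $ q"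
      using run_above_subsolution[OF x T r init, of g u0] sub by blast
    ultimately show ?thesis
      by (intro tendsto_slope_from_lines)
  qed
  have least: "g $ q \<le> h $ q"
    if h: "\<And>q. \<sigma> q \<in> acts q \<and> h $ q = avg q (\<sigma> q) h \<and> u $ q + tau (\<sigma> q) * h $ q = r q (\<sigma> q) + avg q (\<sigma> q) u"
    for \<sigma> h u q
  proof -
    obtain x where x: "is_run r x" and x0: "\<And>t. t \<le> 0 \<Longrightarrow> x t = 0"
      using run_exists[of r] by blast
    have init: "\<bar>x t $ q\<bar> \<le> 0" if "- T \<le> t" "t \<le> 0" for t q
      using x0[OF that(2)] by simp
    obtain C where C: "\<And>t q. 0 \<le> t \<Longrightarrow> x t $ q \<le> t * h $ q + C"
      using run_below_policy_line[OF x T init, of \<sigma> h u] h by blast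
    have "((\<lambda>t. h $ q + C / t) \<longlongrightarrow> h $ q + 0) at_top"
      by (intro tendsto_intros tendsto_divide_0[OF tendsto_const] filterlim_at_top_imp_at_infinity filterlim_ident)
    moreover have "\<forall>\<^sub>F t in at_top. x t $ q / t \<le> h $ q + C / t"
      using eventually_ge_at_top[of 1]
      by (rule eventually_mono) (use C in \<open>auto simp: field_simps\<close>)
    ultimately have "g $ q \<le> h $ q + 0"
      using rate[OF x init] by (intro tendsto_le[OF trivial_limit_at_top_linorder])
    then show ?thesis
      by simp
  qed
  have "(MIN \<sigma>\<in>{\<sigma>. \<forall>q. \<sigma> q \<in> acts q}. policy_gain r \<sigma> q) = g $ q"
  proof (rule Min_eqI)
    show "finite ((\<lambda>\<sigma>. policy_gain r \<sigma> q) ` {\<sigma>. \<forall>q. \<sigma> q \<in> acts q})"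
      by (rule finite_imageI) simp
    show "g $ q \<in> (\<lambda>\<sigma>. policy_gain r \<sigma> q) ` {\<sigma>. \<forall>q. \<sigma> q \<in> acts q}"
    proof (rule image_eqI)
      show "g $ q = policy_gain r \<sigma>0 q"
        by (rule gain_eq_policy_gain[of \<sigma>0 g u0]) (rule eqs)
    qed (use eqs in blast)
    fix y assume "y \<in> (\<lambda>\<sigma>. policy_gain r \<sigma> q) ` {\<sigma>. \<forall>q. \<sigma> q \<in> acts q}"
    then obtain \<sigma> where \<sigma>: "\<forall>q. \<sigma> q \<in> acts q" and y: "y = policy_gain r \<sigma> q"
      by blast
    obtain h u where h: "\<forall>q. h $ q = avg q (\<sigma> q) h \<and>
        u $ q + tau (\<sigma> q) * h $ q = (\<chi> q. r q (\<sigma> q)) $ q + avg q (\<sigma> q) u"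
      using policy_evaluation_exists[OF \<sigma>] by blast
    have eqs_h: "\<sigma> q \<in> acts q \<and> h $ q = avg q (\<sigma> q) h \<and>
        u $ q + tau (\<sigma> q) * h $ q = r q (\<sigma> q) + avg q (\<sigma> q) u" for q
      using h \<sigma> unfolding vec_lambda_beta by blast
    have "g $ q \<le> h $ q"
      by (rule least[of \<sigma> h u]) (rule eqs_h)
    also have "h $ q = y"
      unfolding y by (rule gain_eq_policy_gain[of \<sigma> h u]) (rule eqs_h)
    finally show "g $ q \<le> y" .
  qed
  then show ?thesis
    using rate[OF x init] by simp
qed

end

section \<open>Fluid Petri nets as semi-Markov decision processes\<close>

definition net_kernel :: "('p, 'q) petri_net \<Rightarrow> real ^ 'q \<Rightarrow> 'q \<Rightarrow> 'p \<Rightarrow> 'q \<Rightarrow> real" where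
  "net_kernel N e q p j = inverse (e $ q) * routing N q p * inverse (weight_PT N q p) *
     (if j \<in> place_in N p then weight_TP N p j else 0) * e $ j"

definition net_cost :: "('p, 'q) petri_net \<Rightarrow> real ^ 'q \<Rightarrow> 'q \<Rightarrow> 'p \<Rightarrow> real" where
  "net_cost N e q p = inverse (e $ q) * inverse (weight_PT N q p) * routing N q p * marking N p"

text \<open>
  The number of vertices from which the transition can be reached through places with zero holding
  time; in a non-Zeno net it increases strictly along such connections.
\<close>

definition instant_level :: "('p, 'q) petri_net \<Rightarrow> 'q \<Rightarrow> nat" where
  "instant_level N q = (let V = {Inl p | p. holding N p = 0} \<union> range Inr in
     card {y. (y, Inr q) \<in> (net_digraph N \<inter> V \<times> V)\<^sup>+})"

lemma instant_level_decreases: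
  fixes N :: "('p::finite, 'q::finite) petri_net"
  assumes "non_zeno N" "p \<in> trans_in N q" "holding N p = 0" "j \<in> place_in N p"
  shows "instant_level N j < instant_level N q"
proof -
  define V :: "('p + 'q) set" where "V = {Inl p | p. holding N p = 0} \<union> range Inr"
  define R where "R = net_digraph N \<inter> V \<times> V"
  have acyclic: "acyclic R"
    using assms(1) by (simp add: non_zeno_def R_def V_def Let_def)
  have "(Inr j, Inl p) \<in> R" "(Inl p, Inr q) \<in> R"
    using assms by (auto simp: R_def V_def net_digraph_def trans_in_def place_in_def)
  then have jq: "(Inr j, Inr q) \<in> R\<^sup>+"
    by (meson trancl.simps)
  have "{y. (y, Inr j) \<in> R\<^sup>+} \<subset> {y. (y, Inr q) \<in> R\<^sup>+}"
  proof
    show "{y. (y, Inr j) \<in> R\<^sup>+} \<subseteq> {y. (y, Inr q) \<in> R\<^sup>+}"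
      using jq by (auto intro: trancl_trans)
    have "(Inr j, Inr j) \<notin> R\<^sup>+"
      using acyclic by (simp add: acyclic_def)
    then show "{y. (y, Inr j) \<in> R\<^sup>+} \<noteq> {y. (y, Inr q) \<in> R\<^sup>+}"
      using jq by blast
  qed
  then show ?thesis
    unfolding instant_level_def Let_def V_def[symmetric] R_def[symmetric]
    by (intro psubset_card_mono) auto
qed

lemma routing_nonneg:
  assumes "fluid_petri_net N" "p \<in> trans_in N q"
  shows "0 \<le> routing N q p"
proof -
  have "q \<in> place_out N p"
    using assms(2) by (simp add: trans_in_def place_out_def)
  moreover have "ruled_by_preselection N p \<or> conflict_free N p"
    using assms(1) by (simp add: fluid_petri_net_def)
  ultimately show ?thesis
    by (auto simp: ruled_by_preselection_def conflict_free_def)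
qed

lemma weight_PT_pos:
  assumes "fluid_petri_net N" "p \<in> trans_in N q"
  shows "0 < weight_PT N q p"
  using assms by (auto simp: fluid_petri_net_def trans_in_def)

lemma weight_TP_pos:
  assumes "fluid_petri_net N" "q \<in> place_in N p"
  shows "0 < weight_TP N p q"
  using assms by (auto simp: fluid_petri_net_def place_in_def)

lemma net_kernel_sum:
  "(\<Sum>j\<in>UNIV. net_kernel N e q p j * x $ j) =
    inverse (e $ q) * (routing N q p * inverse (weight_PT N q p) *
      (\<Sum>j\<in>place_in N p. weight_TP N p j * (e $ j * x $ j)))"
proof -
  have "(\<Sum>j\<in>UNIV. net_kernel N e q p j * x $ j) =
      (\<Sum>j\<in>UNIV. if j \<in> place_in N p then inverse (e $ q) * (routing N q p * inverse (weight_PT N q p) *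
        (weight_TP N p j * (e $ j * x $ j))) else 0)"
    by (intro sum.cong) (simp_all add: net_kernel_def)
  also have "\<dots> = (\<Sum>j\<in>place_in N p. inverse (e $ q) * (routing N q p * inverse (weight_PT N q p) *
        (weight_TP N p j * (e $ j * x $ j))))"
    by (simp add: sum.If_cases)
  finally show ?thesis
    by (simp add: sum_distrib_left)
qed

text \<open>
  The invariant is exactly what normalizes the kernel, and non-Zenoness is exactly the level condition.
\<close>

lemma semi_markov_decision_net:
  fixes N :: "('p::finite, 'q::finite) petri_net"
  assumes N: "fluid_petri_net N" "non_zeno N"
    and e: "stoichiometric_invariant N e" "\<forall>q. 0 < e $ q"
  shows "semi_markov_decision (trans_in N) (net_kernel N e) (holding N) (instant_level N)"
proof
  show "trans_in N q \<noteq> {}" for q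
    using N(1) by (simp add: fluid_petri_net_def)
  show "0 \<le> holding N p" for p
    using N(1) by (simp add: fluid_petri_net_def)
  fix p q assume p: "p \<in> trans_in N q"
  show "0 \<le> net_kernel N e q p j" for j
    using routing_nonneg[OF N(1) p] weight_PT_pos[OF N(1) p] weight_TP_pos[OF N(1), of j p] e(2)
    by (auto simp: net_kernel_def less_imp_le intro!: mult_nonneg_nonneg)
  have "(\<Sum>j\<in>UNIV. net_kernel N e q p j) = (\<Sum>j\<in>UNIV. net_kernel N e q p j * (vec 1 :: real ^ 'q) $ j)"
    by simp
  also have "\<dots> = inverse (e $ q) * e $ q"
    unfolding net_kernel_sum using e(1) p by (simp add: stoichiometric_invariant_def)
  also have "\<dots> = 1"
    using e(2) by (simp add: less_imp_neq[symmetric])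
  finally show "(\<Sum>j\<in>UNIV. net_kernel N e q p j) = 1" .
  fix j assume instant: "holding N p = 0" and "0 < net_kernel N e q p j"
  then have "j \<in> place_in N p"
    by (simp add: net_kernel_def split: if_splits)
  with instant show "instant_level N j < instant_level N q"
    by (rule instant_level_decreases[OF N(2) p])
qed

text \<open>
  The change of variables between a trajectory and a run, for a single place.
\<close>

lemma rescaled_equation:
  assumes "e $ q \<noteq> 0"
  shows "e $ q * (net_cost N e q p + (\<Sum>j\<in>UNIV. net_kernel N e q p j * x $ j)) =
    routing N q p * inverse (weight_PT N q p) *
      (marking N p + (\<Sum>j\<in>place_in N p. weight_TP N p j * (e $ j * x $ j)))"
proof -
  have cancel: "e $ q * (inverse (e $ q) * c) = c" for c
    using assms by simp
  have "net_cost N e q p = inverse (e $ q) * (routing N q p * inverse (weight_PT N q p) * marking N p)"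
    by (simp add: net_cost_def)
  then show ?thesis
    unfolding net_kernel_sum by (simp only: distrib_left cancel)
qed

lemma trajectory_iff_run:
  fixes N :: "('p::finite, 'q::finite) petri_net"
  assumes D: "semi_markov_decision (trans_in N) (net_kernel N e) (holding N) lev"
    and e: "\<forall>q. 0 < e $ q"
  shows "trajectory N (\<lambda>t. \<chi> q. e $ q * x t $ q) \<longleftrightarrow>
    semi_markov_decision.is_run (trans_in N) (net_kernel N e) (holding N) (net_cost N e) x"
proof -
  interpret semi_markov_decision "trans_in N" "net_kernel N e" "holding N" lev
    by (rule D)
  have eq: "(MIN p\<in>trans_in N q. routing N q p * inverse (weight_PT N q p) *
        (marking N p + (\<Sum>j\<in>place_in N p. weight_TP N p j * (e $ j * x (t - holding N p) $ j)))) =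
      e $ q * (MIN p\<in>trans_in N q. net_cost N e q p + avg q p (x (t - holding N p)))" for q t
  proof -
    have "mono ((*) (e $ q))"
      using e by (intro monoI mult_left_mono) (simp_all add: less_imp_le)
    then have "e $ q * (MIN p\<in>trans_in N q. net_cost N e q p + avg q p (x (t - holding N p))) =
        (MIN p\<in>trans_in N q. e $ q * (net_cost N e q p + avg q p (x (t - holding N p))))"
      using acts_nonempty[of q] by (subst mono_Min_commute) (simp_all add: image_image)
    moreover have e0: "e $ q \<noteq> 0"
      using e by (simp add: less_imp_neq[symmetric])
    ultimately show ?thesis
      by (simp only: avg_def rescaled_equation[OF e0])
  qed
  have "e $ q \<noteq> 0" for q
    using e by (simp add: less_imp_neq[symmetric])
  then show ?thesis
    unfolding trajectory_def is_run_def vec_lambda_beta eq by simp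
qed

theorem corollary6p13:
  fixes N :: "('p::finite, 'q::finite) petri_net"
    and e :: "real ^ 'q"
  assumes "fluid_petri_net N"
    and "non_zeno N"
    and "stoichiometric_invariant N e"
    and "\<forall>q. 0 < e $ q"
  shows "has_throughput N (throughput N) \<and>
    (\<forall>q. throughput N $ q =
       e $ q * (MIN \<sigma>\<in>policies N.
         \<Sum>F\<in>final_classes (policy_matrix N e \<sigma>).
           reach_prob (policy_matrix N e \<sigma>) F q *
           (invariant_measure (policy_matrix N e \<sigma>) F \<bullet> (policy_diag N e \<sigma> *v policy_marking N \<sigma>) /
            (invariant_measure (policy_matrix N e \<sigma>) F \<bullet> policy_holding N \<sigma>))))"
proof -
  note D = semi_markov_decision_net[OF assms]
  interpret semi_markov_decision "trans_in N" "net_kernel N e" "holding N" "instant_level N"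
    by (rule D)
  have e: "e $ q \<noteq> 0" for q
    using assms(4) by (simp add: less_imp_neq[symmetric])
  define M where "M q = (MIN \<sigma>\<in>policies N. policy_gain (net_cost N e) \<sigma> q)" for q
  define \<rho> :: "real ^ 'q" where "\<rho> = (\<chi> q. e $ q * M q)"
  have cost: "0 \<le> net_cost N e q p" if p: "p \<in> trans_in N q" for q p
    using routing_nonneg[OF assms(1) p] weight_PT_pos[OF assms(1) p] assms(1,4)
    by (simp add: net_cost_def fluid_petri_net_def less_imp_le)
  have T: "holding N p \<le> max_holding N" for p
    by (simp add: max_holding_def)
  have limit: "((\<lambda>t. z t /\<^sub>R t) \<longlongrightarrow> \<rho>) at_top" if z: "cont_start_trajectory N z" for z
  proof -
    define x :: "real \<Rightarrow> real ^ 'q" where "x t = (\<chi> q. z t $ q / e $ q)" for t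
    have zx: "z = (\<lambda>t. \<chi> q. e $ q * x t $ q)"
      using e by (simp add: fun_eq_iff vec_eq_iff x_def)
    have run: "is_run (net_cost N e) x"
      using z trajectory_iff_run[OF D assms(4), of x] unfolding cont_start_trajectory_def zx[symmetric] by simp
    have "continuous_on {- max_holding N..0} x"
      using z e unfolding x_def cont_start_trajectory_def by (intro continuous_intros) auto
    then have "compact (x ` {- max_holding N..0})"
      by (intro compact_continuous_image) auto
    then obtain B where B: "\<And>t. t \<in> {- max_holding N..0} \<Longrightarrow> norm (x t) \<le> B"
      using compact_imp_bounded bounded_iff by (metis imageI)
    have init: "\<bar>x t $ q\<bar> \<le> B" if "- max_holding N \<le> t" "t \<le> 0" for t q
      using B[of t] that component_le_norm_cart[of "x t" q] by simp
    have "((\<lambda>t. x t $ q / t) \<longlongrightarrow> M q) at_top" for q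
      using run_growth_rate_formula[OF cost T run init, of q] by (simp add: M_def policies_def)
    then have "((\<lambda>t. e $ q * (x t $ q / t)) \<longlongrightarrow> e $ q * M q) at_top" for q
      by (intro tendsto_intros)
    then show ?thesis
      by (intro vec_tendstoI) (simp add: \<rho>_def zx divide_inverse mult_ac)
  qed
  obtain x where x: "is_run (net_cost N e) x" and x0: "\<And>t. t \<le> 0 \<Longrightarrow> x t = 0"
    using run_exists by blast
  have "continuous_on {- max_holding N..0} (\<lambda>t. (\<chi> q. e $ q * x t $ q) :: real ^ 'q)"
    by (rule continuous_on_eq[where f = "\<lambda>_. 0"]) (simp_all add: x0 vec_eq_iff)
  then have start: "cont_start_trajectory N (\<lambda>t. \<chi> q. e $ q * x t $ q)"
    using x trajectory_iff_run[OF D assms(4), of x] by (simp add: cont_start_trajectory_def)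
  have has: "has_throughput N \<rho>"
    unfolding has_throughput_def using start limit by blast
  have "throughput N = \<rho>"
    unfolding throughput_def
  proof (rule the_equality[where P = "has_throughput N", OF has])
    fix \<rho>' assume "has_throughput N \<rho>'"
    then show "\<rho>' = \<rho>"
      using start limit[OF start] tendsto_unique[OF trivial_limit_at_top_linorder]
      unfolding has_throughput_def by blast
  qed
  moreover have "policy_matrix N e \<sigma> = kernel_matrix \<sigma>" for \<sigma>
    by (simp add: policy_matrix_def kernel_matrix_def net_kernel_def)
  moreover have "policy_diag N e \<sigma> *v policy_marking N \<sigma> = (\<chi> q. net_cost N e q (\<sigma> q))" for \<sigma>
    by (simp add: vec_eq_iff policy_diag_def policy_marking_def net_cost_def matrix_vector_mult_def
        if_distrib[of "\<lambda>x. x * _"] cong: if_cong)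
  moreover have "policy_holding N \<sigma> = (\<chi> q. holding N (\<sigma> q))" for \<sigma>
    by (simp add: policy_holding_def)
  ultimately show ?thesis
    using has by (simp add: \<rho>_def M_def policy_gain_def)
qed

end
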